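(* There is an absolute constant $\delta'>0$ such that the online matching problem for general (not necessarily bipartite) graphs in the random edge arrival model admits a randomized online algorithm that is $\left(\frac12+\delta'\right)$-competitive.
   Context: Online matching in the random edge arrival model: a graph $G=(W,E)$ with $m=|E|$ is fixed adversarially; its edges are revealed one at a time in a uniformly random order. The algorithm knows $m$ but not the graph; upon arrival of an edge it must immediately and irrevocably decide whether to add it to its matching, and the picked edges must always form a matching. $\textsc{OPT}$ is a maximum matching of $G$. An algorithm is $c$-competitive if on every graph the expected size of its matching (over the random order and its internal coins) is at least $c\,|\textsc{OPT}|$. *)

theory Defs
  imports "HOL-Probability.Probability" "HOL-Combinatorics.Multiset_Permutations"
begin

text \<open>Graphs: vertices are natural numbers (any finite graph can be so labelled);
  a graph is a finite set of edges, each edge a 2-element vertex set.\<close>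

definition is_graph :: "nat set set \<Rightarrow> bool" where
  "is_graph E \<longleftrightarrow> finite E \<and> (\<forall>e\<in>E. card e = 2)"

definition is_matching :: "nat set set \<Rightarrow> nat set set \<Rightarrow> bool" where
  "is_matching E M \<longleftrightarrow> M \<subseteq> E \<and> (\<forall>e\<in>M. \<forall>f\<in>M. e \<noteq> f \<longrightarrow> e \<inter> f = {})"

definition opt_matching_size :: "nat set set \<Rightarrow> nat" where
  "opt_matching_size E = Max (card ` {M. is_matching E M})"

text \<open>A randomized online algorithm: given m (the number of edges), the history
  (edges arrived so far, each with whether it was added to the matching) and the
  newly arrived edge, it returns the distribution of its decision (accept or not).
  Its internal coins are thus modelled as behavioural randomness.\<close>

type_synonym online_alg = "nat \<Rightarrow> (nat set \<times> bool) list \<Rightarrow> nat set \<Rightarrow> bool pmf"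

definition feasible :: "(nat set \<times> bool) list \<Rightarrow> nat set \<Rightarrow> bool" where
  "feasible hist e \<longleftrightarrow> (\<forall>(f, b) \<in> set hist. b \<longrightarrow> e \<inter> f = {})"

text \<open>Running the algorithm on an arrival order. Picked edges must always form a
  matching: an acceptance of an edge conflicting with the current matching is
  not carried out (the algorithm knows its own matching, so this is w.l.o.g.).\<close>

fun run :: "online_alg \<Rightarrow> nat \<Rightarrow> (nat set \<times> bool) list \<Rightarrow> nat set list
             \<Rightarrow> (nat set \<times> bool) list pmf" where
  "run A m hist [] = return_pmf hist"
| "run A m hist (e # es) =
     bind_pmf (A m hist e) (\<lambda>b. run A m (hist @ [(e, b \<and> feasible hist e)]) es)"

definition matching_size :: "(nat set \<times> bool) list \<Rightarrow> nat" where
  "matching_size hist = length (filter snd hist)"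

definition expected_alg :: "online_alg \<Rightarrow> nat set set \<Rightarrow> real" where
  "expected_alg A E =
     measure_pmf.expectation
       (bind_pmf (pmf_of_set (permutations_of_set E)) (\<lambda>\<sigma>. run A (card E) [] \<sigma>))
       (\<lambda>h. real (matching_size h))"

definition competitive :: "online_alg \<Rightarrow> real \<Rightarrow> bool" where
  "competitive A c \<longleftrightarrow>
     (\<forall>E. is_graph E \<longrightarrow> expected_alg A E \<ge> c * real (opt_matching_size E))"

end

theory Submission
  imports Defs
begin

text \<open>Let \<open>k\<close> be the size of a maximum matching \<open>M\<close>. If Greedy covers both ends of a linear number of
  edges of \<open>M\<close>, it is already better than \<open>1/2\<close>. Otherwise it is hasty: an edge of \<open>M\<close> that is still
  free after the first \<open>l\<close> arrivals would have been picked had it arrived among them, so few edges of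
  \<open>M\<close> are free by then. Hence after a \<open>1/20\<close> fraction of the arrivals Greedy has about \<open>k/2\<close>
  edges, and both ends of most of them are matched by \<open>M\<close> to uncovered vertices: they are middle edges of
  augmenting paths of length three. The algorithm skips each greedy edge of the first phase with
  probability \<open>1/100\<close> and afterwards greedily matches the ends of skipped edges to vertices that
  Greedy had not covered. As few edges are skipped, different skipped edges rarely compete for the
  same vertex, and a skipped edge yields more than one new edge in expectation, the two ends of the
  same edge getting in each other's way with probability at most \<open>1/3\<close> each. Running this algorithm with a
  small probability and Greedy otherwise handles both cases.\<close>

subsection \<open>Greedy matchings and covered vertices\<close>

fun greedy :: "'a set \<Rightarrow> 'a set list \<Rightarrow> 'a set list" where
  "greedy X [] = []"
| "greedy X (e # es) = (if e \<inter> X = {} then e # greedy (X \<union> e) es else greedy X es)"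

definition cov :: "'a set \<Rightarrow> 'a set list \<Rightarrow> 'a set" where
  "cov X es = X \<union> \<Union>(set (greedy X es))"

lemma cov_Nil [simp]: "cov X [] = X"
  by (simp add: cov_def)

lemma cov_Cons [simp]: "cov X (e # es) = (if e \<inter> X = {} then cov (X \<union> e) es else cov X es)"
  by (auto simp: cov_def)

lemma cov_append: "cov X (xs @ ys) = cov (cov X xs) ys"
  by (induction xs arbitrary: X) auto

lemma greedy_append: "greedy X (xs @ ys) = greedy X xs @ greedy (cov X xs) ys"
  by (induction xs arbitrary: X) auto

lemma cov_superset: "X \<subseteq> cov X es"
  by (auto simp: cov_def)

lemma cov_append_superset: "cov X xs \<subseteq> cov X (xs @ ys)"
  by (simp add: cov_append cov_superset)

lemma cov_maximal: "e \<in> set es \<Longrightarrow> e \<noteq> {} \<Longrightarrow> e \<inter> cov X es \<noteq> {}"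
proof (induction es arbitrary: X)
  case (Cons f es)
  show ?case
  proof (cases "e = f")
    case True
    then show ?thesis
      using Cons.prems cov_superset[of "X \<union> f" es] cov_superset[of X es] by auto
  qed (use Cons in auto)
qed auto

lemma finite_cov: "finite X \<Longrightarrow> \<forall>e\<in>set es. finite e \<Longrightarrow> finite (cov X es)"
  by (induction es arbitrary: X) auto

text \<open>Accepted edges are disjoint from each other and from \<open>X\<close>, so each brings
  exactly \<open>c\<close> new vertices of \<open>L\<close>. With \<open>c = 2\<close> and all
  vertices this counts covered vertices; with \<open>c = 1\<close> it counts edges by their ends on
  one side of a cut.\<close>

lemma card_cov_Int:
  assumes "finite X" "\<forall>e\<in>set es. finite e \<and> card (e \<inter> L) = c"
  shows "card (cov X es \<inter> L) = card (X \<inter> L) + c * length (greedy X es)"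
  using assms
proof (induction es arbitrary: X)
  case (Cons e es)
  have "card ((X \<union> e) \<inter> L) = card (X \<inter> L) + card (e \<inter> L)" if "e \<inter> X = {}"
    unfolding Int_Un_distrib2 using Cons.prems that by (intro card_Un_disjoint) auto
  then show ?case
    using Cons by auto
qed auto

text \<open>No accepted edge contains \<open>u\<close>, and blocking more never rescues a rejected
  edge, so every decision stays the same.\<close>

lemma cov_insert_fresh:
  "u \<notin> cov Y es \<Longrightarrow> cov (insert u Y) es = insert u (cov Y es)"
proof (induction es arbitrary: Y)
  case (Cons e es)
  then show ?case
    using cov_superset[of "Y \<union> e" es] cov_superset[of Y es] by (auto split: if_splits)
qed auto

text \<open>The symmetric difference of the two matchings is an alternating path.\<close>

lemma cov_insert_cases:
  assumes "\<forall>e\<in>set es. card e = 2"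
  shows "\<exists>z. cov (insert y X) es = insert z (cov X es) \<or> cov X es = insert z (cov (insert y X) es)"
  using assms
proof (induction es arbitrary: X y)
  case Nil
  show ?case by (intro exI[of _ y]) simp
next
  case (Cons e es)
  then have IH: "\<exists>z. cov (insert y X) es = insert z (cov X es) \<or> cov X es = insert z (cov (insert y X) es)"
    for X y by simp
  consider "y \<in> X" | "y \<notin> X" "e \<inter> X \<noteq> {}" | "y \<notin> X" "e \<inter> X = {}" "y \<notin> e"
    | "y \<notin> X" "e \<inter> X = {}" "y \<in> e" by argo
  then show ?case
  proof cases
    case 1
    then have "y \<in> cov X (e # es)" "insert y X = X" using cov_superset[of X "e # es"] by blast+
    then have "cov (insert y X) (e # es) = insert y (cov X (e # es))" by (simp only: insert_absorb)
    then show ?thesis by blast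
  next
    case 2
    then have "e \<inter> insert y X \<noteq> {}" by auto
    then show ?thesis using IH[of y X] 2 by (simp only: cov_Cons if_False)
  next
    case 3
    then have "e \<inter> insert y X = {}" by auto
    then show ?thesis using IH[of y "X \<union> e"] 3 by (simp only: cov_Cons if_True simp_thms Un_insert_left)
  next
    case 4
    then obtain t where t: "e = {y, t}" using Cons.prems by (auto simp: card_2_iff)
    have "X \<union> e = insert t (insert y X)" "e \<inter> insert y X \<noteq> {}" using t by auto
    then show ?thesis using 4 IH[of t "insert y X"] by (simp only: cov_Cons if_True if_False simp_thms) blast
  qed
qed

text \<open>Only the far end of the alternating path can become newly covered. This bounds how much
  one taken vertex can displace.\<close>

lemma card_cov_insert_diff:
  assumes "\<forall>e\<in>set es. card e = 2"
  shows "finite (cov (insert y X) es - cov X es)" "card (cov (insert y X) es - cov X es) \<le> 1"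
proof -
  obtain z where "cov (insert y X) es = insert z (cov X es) \<or> cov X es = insert z (cov (insert y X) es)"
    using cov_insert_cases[OF assms] by blast
  then have sub: "cov (insert y X) es - cov X es \<subseteq> {z}" by auto
  then show "finite (cov (insert y X) es - cov X es)" by (rule finite_subset) simp
  show "card (cov (insert y X) es - cov X es) \<le> 1" using card_mono[OF _ sub] by simp
qed

lemma cov_split:
  assumes "v \<in> cov Z es" "v \<notin> Z"
  obtains pre e post where "es = pre @ e # post" "v \<in> e" "e \<inter> cov Z pre = {}" "v \<notin> cov Z pre"
  using assms
proof (induction es arbitrary: Z thesis)
  case (Cons e es)
  show ?case
  proof (cases "v \<in> e \<and> e \<inter> Z = {}")
    case True
    then show ?thesis using Cons.prems(1)[of "[]" e es] Cons.prems(3) by auto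
  next
    case False
    define Z' where "Z' = (if e \<inter> Z = {} then Z \<union> e else Z)"
    have "v \<in> cov Z' es" "v \<notin> Z'"
      using False Cons.prems(2,3) by (auto simp: Z'_def split: if_splits)
    then obtain pre f post where "es = pre @ f # post" "v \<in> f" "f \<inter> cov Z' pre = {}" "v \<notin> cov Z' pre"
      using Cons.IH[of Z'] by blast
    then show ?thesis using Cons.prems(1)[of "e # pre" f post] by (auto simp: Z'_def split: if_splits)
  qed
qed auto

text \<open>Freeing the pair \<open>u\<close>, \<open>v\<close> leaves \<open>u\<close> unmatched only if \<open>v\<close> or a chain of displacements
  started by \<open>v\<close> takes \<open>a\<close>. If \<open>v\<close> takes a vertex \<open>c\<close> that the old run uses later, then the new run
  proceeds like the old one with \<open>c\<close> deleted, so its outcome depends on \<open>c\<close> only and not on \<open>v\<close>.\<close>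

lemma unmatched_partner_cases:
  assumes card2: "\<forall>e\<in>set es. card e = 2"
    and uv: "u \<noteq> v" "u \<in> X" "v \<in> X"
    and ua: "{u, a} \<in> set es" and vb: "{v, b} \<in> set es"
    and un: "u \<notin> cov (X - {u, v}) es"
    and free: "a \<notin> cov X es" "b \<notin> cov X es"
  obtains c where "{v, c} \<in> set es" "c \<in> cov X es" "a \<in> cov (insert c X) es"
  | pre post where "es = pre @ {v, a} # post" "{u, a} \<notin> set pre" "{v, b} \<notin> set pre"
proof -
  define Y where "Y = X - {u, v}"
  define Z where "Z = X - {v}"
  have Z: "Z = insert u Y" and X: "X = insert v Z" using uv by (auto simp: Y_def Z_def)
  have un': "u \<notin> cov Y es" using un by (simp add: Y_def)
  have "a \<in> cov Y es" using cov_maximal[OF ua, of Y] un' by auto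
  then have aZ: "a \<in> cov Z es" using cov_insert_fresh[OF un'] Z by auto
  \<comment> \<open>If \<open>v\<close> stayed unmatched, blocking it would change no decision, and
    \<open>a\<close> would be covered from \<open>X\<close> as well.\<close>
  have "v \<in> cov Z es"
    using cov_insert_fresh[of v Z es] X free aZ by auto
  moreover have "v \<notin> Z" by (simp add: Z_def)
  ultimately obtain pre e post where split: "es = pre @ e # post" "v \<in> e" "e \<inter> cov Z pre = {}" "v \<notin> cov Z pre"
    by (rule cov_split)
  then obtain c where e: "e = {v, c}" "c \<noteq> v" using card2 by (auto simp: card_2_iff)
  have Xpre: "cov X pre = insert v (cov Z pre)" using cov_insert_fresh[OF split(4)] X by simp
  have c: "c \<notin> cov X pre" using Xpre e split by auto
  \<comment> \<open>Once \<open>v\<close> has taken \<open>c\<close>, the state is that of the run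
    from \<open>X\<close> with \<open>c\<close> added; since \<open>c\<close> was uncovered so far,
    it may as well have been blocked from the start.\<close>
  have "cov Z pre \<union> e = insert c (cov X pre)" using Xpre e by auto
  then have "cov Z es = cov (insert c (cov X pre)) post"
    using split by (simp add: cov_append)
  also have "\<dots> = cov (insert c X) es"
    using cov_insert_fresh[OF c] split e by (simp add: cov_append)
  finally have eq: "cov Z es = cov (insert c X) es" .
  show ?thesis
  proof (cases "c \<in> cov X es")
    case True
    moreover have "{v, c} \<in> set es" using split(1) e by simp
    ultimately show ?thesis using that(1) eq aZ by simp
  next
    case False
    then have ac: "a = c" using aZ eq cov_insert_fresh[OF False] free by auto
    have sub: "cov X pre \<subseteq> cov X es" "cov Y pre \<subseteq> cov Y es"
      unfolding split(1) by (rule cov_append_superset)+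
    have "{v, b} \<notin> set pre"
    proof
      assume "{v, b} \<in> set pre"
      then have "b \<in> cov Z pre" using cov_maximal[of "{v, b}" pre Z] split by auto
      then show False using Xpre sub free by auto
    qed
    moreover have "{u, a} \<notin> set pre"
    proof
      assume "{u, a} \<in> set pre"
      then have "a \<in> cov Y pre" using cov_maximal[of "{u, a}" pre Y] un' sub by auto
      then have "a \<in> cov Z pre" using cov_insert_fresh[of u Y pre] Z sub un' by auto
      then show False using c ac Xpre by auto
    qed
    ultimately show ?thesis using that(2)[of pre post] split(1) e ac by simp
  qed
qed

subsection \<open>Skipped pairs of the first phase\<close>

definition first_of :: "'b \<Rightarrow> 'b \<Rightarrow> 'b \<Rightarrow> 'b list \<Rightarrow> bool" where
  "first_of x y z xs \<longleftrightarrow> (\<exists>pre post. xs = pre @ x # post \<and> y \<notin> set pre \<and> z \<notin> set pre)"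

text \<open>The situation after the first phase: the \<open>e j\<close> are the greedy edges,
  \<open>L\<close> their vertices, \<open>W\<close> the ends whose partner \<open>mate\<close> in
  the maximum matching is outside \<open>L\<close> with the joining edge still to come, and
  \<open>es\<close> the later arrivals with exactly one end in \<open>L\<close>. Below,
  \<open>B j\<close> means that pair \<open>j\<close> is skipped, which leaves its ends
  available.\<close>

locale skipped_pairs =
  fixes I :: "nat set" and e :: "nat \<Rightarrow> 'a set" and W :: "'a set" and mate :: "'a \<Rightarrow> 'a"
    and L :: "'a set" and es :: "'a set list"
  assumes fin: "finite I"
    and card_pair: "j \<in> I \<Longrightarrow> card (e j) = 2"
    and disj: "i \<in> I \<Longrightarrow> j \<in> I \<Longrightarrow> i \<noteq> j \<Longrightarrow> e i \<inter> e j = {}"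
    and L_eq: "L = \<Union>(e ` I)"
    and mate_L: "w \<in> W \<Longrightarrow> mate w \<notin> L"
    and mate_inj: "inj_on mate W"
    and es_card: "f \<in> set es \<Longrightarrow> card f = 2"
    and es_L: "f \<in> set es \<Longrightarrow> card (f \<inter> L) = 1"
    and mate_es: "w \<in> W \<Longrightarrow> {w, mate w} \<in> set es"
begin

text \<open>Good pairs are the middle edges of augmenting paths of length three.\<close>

definition good :: "nat set" where "good = {j \<in> I. e j \<subseteq> W}"

definition blocked :: "(nat \<Rightarrow> bool) \<Rightarrow> 'a set" where "blocked B = \<Union>(e ` {j \<in> I. \<not> B j})"

definition gain :: "(nat \<Rightarrow> bool) \<Rightarrow> nat" where "gain B = length (greedy (blocked B) es)"

definition other :: "nat \<Rightarrow> 'a \<Rightarrow> 'a" where "other j w = the_elem (e j - {w})"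

definition hit :: "(nat \<Rightarrow> bool) \<Rightarrow> 'a set" where "hit B = cov (blocked B) es - L"

text \<open>The union is over every hit vertex \<open>c\<close>, not just the one that a particular
  freed end takes. So the set does not depend on the pair under consideration and can be bounded
  once for all pairs.\<close>

definition displaced :: "(nat \<Rightarrow> bool) \<Rightarrow> 'a set" where
  "displaced B = (\<Union>c\<in>hit B. cov (insert c (blocked B)) es - cov (blocked B) es)"

text \<open>The losses of pair \<open>j\<close> that are due to other skipped pairs. It is evaluated
  at \<open>B(j := False)\<close>, which makes it independent of the coin of
  \<open>j\<close>.\<close>

definition charge :: "(nat \<Rightarrow> bool) \<Rightarrow> nat \<Rightarrow> real" where
  "charge B j = (\<Sum>w\<in>e j. of_bool (mate w \<in> hit B) + of_bool (mate (other j w) \<in> hit B)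
      + of_bool (mate w \<in> displaced B))"

text \<open>The loss inside a pair: one end may take the partner of the other before either end sees
  the edge to its own partner. Only the arrival order matters, not \<open>B\<close>.\<close>

definition clash :: "nat \<Rightarrow> real" where
  "clash j = (\<Sum>w\<in>e j. of_bool (first_of {other j w, mate w} {w, mate w} {other j w, mate (other j w)} es))"

section \<open>Counting the gain on both sides of the cut\<close>

lemma finite_pair: "j \<in> I \<Longrightarrow> finite (e j)"
  using card_pair by (metis card.infinite zero_neq_numeral)

lemma finite_edge: "f \<in> set es \<Longrightarrow> finite f"
  using es_card by (metis card.infinite zero_neq_numeral)

lemma finite_L: "finite L"
  using fin finite_pair by (auto simp: L_eq)

lemma blocked_L: "blocked B \<subseteq> L"
  by (auto simp: L_eq blocked_def)

lemma finite_blocked: "finite (blocked B)"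
  using finite_subset[OF blocked_L finite_L] .

lemma finite_cov_blocked: "finite (cov (blocked B) es)"
  using finite_blocked finite_edge by (intro finite_cov) auto

lemma card_hit: "card (hit B) = gain B"
proof -
  have "card (f \<inter> - L) = 1" if "f \<in> set es" for f
  proof -
    have "card f = card (f \<inter> L) + card (f - L)"
      using finite_edge[OF that] by (metis card_Int_Diff)
    then show ?thesis using es_card[OF that] es_L[OF that] by (simp add: Diff_eq)
  qed
  then have "card (cov (blocked B) es \<inter> - L) = card (blocked B \<inter> - L) + 1 * length (greedy (blocked B) es)"
    using finite_edge finite_blocked by (intro card_cov_Int) auto
  moreover have "blocked B \<inter> - L = {}" using blocked_L by auto
  ultimately show ?thesis by (simp add: hit_def gain_def Diff_eq)
qed

lemma finite_hit: "finite (hit B)"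
  using finite_cov_blocked by (simp add: hit_def)

text \<open>There are \<open>gain B\<close> hit vertices, and each displaces at most one
  vertex.\<close>

lemma finite_displaced: "finite (displaced B)" and card_displaced: "card (displaced B) \<le> gain B"
proof -
  note diff = card_cov_insert_diff[of es, OF ballI[OF es_card]]
  show "finite (displaced B)"
    unfolding displaced_def using finite_hit diff by blast
  have "card (displaced B) \<le> (\<Sum>c\<in>hit B. card (cov (insert c (blocked B)) es - cov (blocked B) es))"
    unfolding displaced_def by (rule card_UN_le[OF finite_hit])
  also have "\<dots> \<le> (\<Sum>c\<in>hit B. 1)" by (intro sum_mono diff)
  finally show "card (displaced B) \<le> gain B" by (simp add: card_hit)
qed

lemma card_Int_L: "X \<subseteq> L \<Longrightarrow> card X = (\<Sum>j\<in>I. card (e j \<inter> X))"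
proof -
  assume "X \<subseteq> L"
  then have "X = (\<Union>j\<in>I. e j \<inter> X)" by (auto simp: L_eq)
  also have "card \<dots> = (\<Sum>j\<in>I. card (e j \<inter> X))"
    using fin finite_pair disj by (intro card_UN_disjoint) blast+
  finally show ?thesis .
qed

text \<open>Counts accepted edges by their ends in \<open>L\<close>, which lie in skipped pairs
  because the other pairs are blocked throughout; \<open>card_hit\<close> counts the same edges by
  their ends outside \<open>L\<close>.\<close>

lemma gain_eq: "gain B = (\<Sum>j\<in>I. of_bool (B j) * card (e j \<inter> cov (blocked B) es))"
proof -
  let ?C = "cov (blocked B) es"
  have "card (?C \<inter> L) = card (blocked B \<inter> L) + 1 * gain B"
    unfolding gain_def using finite_edge finite_blocked es_L by (intro card_cov_Int) auto
  moreover have "blocked B \<inter> L = blocked B" using blocked_L by auto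
  moreover have "card (?C \<inter> L) = (\<Sum>j\<in>I. card (e j \<inter> ?C))"
    using card_Int_L[of "?C \<inter> L"] L_eq by (simp, intro sum.cong) (auto intro!: arg_cong[of _ _ card])
  moreover have "card (blocked B) = (\<Sum>j\<in>I. card (e j \<inter> blocked B))"
    using card_Int_L[OF blocked_L] .
  moreover have "card (e j \<inter> ?C) = card (e j \<inter> blocked B) + of_bool (B j) * card (e j \<inter> ?C)" if "j \<in> I" for j
  proof (cases "B j")
    case True
    then have "e j \<inter> blocked B = {}" using disj that unfolding blocked_def by blast
    then show ?thesis using True by simp
  next
    case False
    then have "e j \<subseteq> blocked B" using that by (auto simp: blocked_def)
    then have "e j \<inter> ?C = e j \<inter> blocked B" using cov_superset[of "blocked B" es] by blast
    then show ?thesis using False by simp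
  qed
  then have "(\<Sum>j\<in>I. card (e j \<inter> ?C)) =
      (\<Sum>j\<in>I. card (e j \<inter> blocked B)) + (\<Sum>j\<in>I. of_bool (B j) * card (e j \<inter> ?C))"
    by (simp add: sum.distrib[symmetric])
  ultimately show ?thesis by simp
qed

section \<open>Charging the unmatched ends of good pairs\<close>

lemma good_I: "good \<subseteq> I" by (auto simp: good_def)

lemma finite_good: "finite good" using finite_subset[OF good_I fin] .

lemma gain_ge: "(\<Sum>j\<in>good. of_bool (B j) * real (card (e j \<inter> cov (blocked B) es))) \<le> real (gain B)"
  unfolding gain_eq of_nat_sum of_nat_mult of_nat_of_bool using fin good_I by (intro sum_mono2) auto

lemma other:
  assumes "j \<in> I" "w \<in> e j"
  shows "e j = {w, other j w}" "other j w \<noteq> w"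
proof -
  obtain x y where xy: "e j = {x, y}" "x \<noteq> y"
    using card_pair[OF assms(1)] by (auto simp: card_2_iff)
  then have "e j - {w} = {if w = x then y else x}" using assms(2) by auto
  then have "other j w = (if w = x then y else x)" by (simp add: other_def)
  then show "e j = {w, other j w}" "other j w \<noteq> w" using xy assms(2) by auto
qed

text \<open>If neither partner is hit while \<open>j\<close> is blocked,
  \<open>unmatched_partner_cases\<close> applies to the freed pair. The vertex \<open>c\<close>
  taken by the other end is outside \<open>L\<close>, since edges of \<open>es\<close> have only one
  end there; so \<open>c\<close> is hit and \<open>mate w\<close> is displaced by it.\<close>

lemma unmatched_charged:
  assumes j: "j \<in> good" and w: "w \<in> e j" and "\<not> B j"
    and un: "w \<notin> cov (blocked (B(j := True))) es"
  shows "mate w \<in> hit B \<or> mate (other j w) \<in> hit B \<or> mate w \<in> displaced B \<or>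
    first_of {other j w, mate w} {w, mate w} {other j w, mate (other j w)} es"
proof -
  let ?v = "other j w"
  have jI: "j \<in> I" and W: "e j \<subseteq> W" using j by (auto simp: good_def)
  note o = other[OF jI w]
  have uvW: "w \<in> W" "?v \<in> W" using o W by auto
  have in_b: "w \<in> blocked B" "?v \<in> blocked B" using o \<open>\<not> B j\<close> jI by (auto simp: blocked_def)
  have "blocked (B(j := True)) = blocked B - e j"
  proof -
    have "{i \<in> I. \<not> (B(j := True)) i} = {i \<in> I. \<not> B i} - {j}" by auto
    moreover have "e i - e j = e i" if "i \<in> I" "i \<noteq> j" for i using disj[OF that(1) jI that(2)] by auto
    ultimately show ?thesis unfolding blocked_def by auto
  qed
  then have un': "w \<notin> cov (blocked B - {w, ?v}) es" using un o by simp
  show ?thesis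
  proof (cases "mate w \<in> cov (blocked B) es \<or> mate ?v \<in> cov (blocked B) es")
    case True
    then show ?thesis using mate_L uvW by (auto simp: hit_def)
  next
    case False
    have card2: "\<forall>f\<in>set es. card f = 2" using es_card by blast
    show ?thesis
    proof (rule unmatched_partner_cases[OF card2 o(2)[symmetric] in_b mate_es mate_es un'])
      show "w \<in> W" "?v \<in> W" by fact+
      show "mate w \<notin> cov (blocked B) es" "mate ?v \<notin> cov (blocked B) es" using False by auto
    next
      fix c assume c: "{?v, c} \<in> set es" "c \<in> cov (blocked B) es" "mate w \<in> cov (insert c (blocked B)) es"
      have "?v \<in> L" using in_b blocked_L by auto
      have "c \<notin> L"
      proof
        assume "c \<in> L"
        then have "{?v, c} \<inter> L = {?v, c}" using \<open>?v \<in> L\<close> by auto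
        then show False using es_card[OF c(1)] es_L[OF c(1)] by simp
      qed
      then have "mate w \<in> displaced B" using c False by (auto simp: hit_def displaced_def)
      then show ?thesis by simp
    qed (auto simp: first_of_def)
  qed
qed

lemma two_le_matched:
  assumes "j \<in> good"
  shows "2 \<le> real (card (e j \<inter> cov (blocked (B(j := True))) es)) + charge (B(j := False)) j + clash j"
proof -
  let ?C = "cov (blocked (B(j := True))) es"
  have jI: "j \<in> I" using assms good_I by auto
  have "2 = (\<Sum>w\<in>e j. 1::real)" using card_pair[OF jI] by simp
  also have "\<dots> \<le> (\<Sum>w\<in>e j. of_bool (w \<in> ?C) +
      (of_bool (mate w \<in> hit (B(j := False))) + of_bool (mate (other j w) \<in> hit (B(j := False)))
      + of_bool (mate w \<in> displaced (B(j := False)))) +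
      of_bool (first_of {other j w, mate w} {w, mate w} {other j w, mate (other j w)} es))"
  proof (rule sum_mono)
    fix w assume w: "w \<in> e j"
    show "1 \<le> of_bool (w \<in> ?C) +
      (of_bool (mate w \<in> hit (B(j := False))) + of_bool (mate (other j w) \<in> hit (B(j := False)))
      + of_bool (mate w \<in> displaced (B(j := False)))) +
      (of_bool (first_of {other j w, mate w} {w, mate w} {other j w, mate (other j w)} es) :: real)"
      using unmatched_charged[OF assms w, of "B(j := False)"] by (auto simp: of_bool_def)
  qed
  also have "\<dots> = real (card (e j \<inter> ?C)) + charge (B(j := False)) j + clash j"
    using finite_pair[OF jI] by (simp add: sum.distrib charge_def clash_def Int_def)
  finally show ?thesis .
qed

lemma sum_other: "j \<in> I \<Longrightarrow> (\<Sum>w\<in>e j. f (other j w)) = (\<Sum>w\<in>e j. f w)"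
proof -
  assume jI: "j \<in> I"
  obtain u v where uv: "e j = {u, v}" "u \<noteq> v"
    using card_pair[OF jI] by (auto simp: card_2_iff)
  then have "other j u = v" "other j v = u"
    using other[OF jI, of u] other[OF jI, of v] by auto
  then show ?thesis using uv by (simp add: add.commute)
qed

lemma sum_good_le:
  assumes "finite H"
  shows "(\<Sum>j\<in>good. \<Sum>w\<in>e j. of_bool (mate w \<in> H)) \<le> real (card H)"
proof -
  let ?V = "\<Union>j\<in>good. e j"
  have finV: "finite ?V" using finite_good finite_pair good_I by auto
  have "(\<Sum>j\<in>good. \<Sum>w\<in>e j. of_bool (mate w \<in> H)) = (\<Sum>w\<in>?V. of_bool (mate w \<in> H) :: real)"
    using finite_good finite_pair good_I disj by (intro sum.UNION_disjoint[symmetric]) blast+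
  also have "\<dots> = real (card {w \<in> ?V. mate w \<in> H})" using finV by (simp add: Int_def)
  also have "card {w \<in> ?V. mate w \<in> H} = card (mate ` {w \<in> ?V. mate w \<in> H})"
    by (rule card_image[symmetric], rule inj_on_subset[OF mate_inj]) (auto simp: good_def)
  also have "\<dots> \<le> card H" using assms by (intro card_mono) auto
  finally show ?thesis by simp
qed

lemma charge_nonneg: "0 \<le> charge B j"
  by (auto simp: charge_def intro!: sum_nonneg)

text \<open>Pairs are disjoint and \<open>mate\<close> is injective, so a hit vertex is charged at
  most twice, by its partner and by the other end of that pair, and a displaced vertex at most once.
  Both sets have at most \<open>gain B\<close> elements.\<close>

lemma sum_charge_le: "(\<Sum>j\<in>good. of_bool (\<not> B j) * charge B j) \<le> 3 * real (gain B)"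
proof -
  have "(\<Sum>j\<in>good. of_bool (\<not> B j) * charge B j) \<le> (\<Sum>j\<in>good. charge B j)"
    using charge_nonneg by (intro sum_mono) auto
  also have "\<dots> = 2 * (\<Sum>j\<in>good. \<Sum>w\<in>e j. of_bool (mate w \<in> hit B)) +
      (\<Sum>j\<in>good. \<Sum>w\<in>e j. of_bool (mate w \<in> displaced B))"
  proof -
    have "charge B j = 2 * (\<Sum>w\<in>e j. of_bool (mate w \<in> hit B)) + (\<Sum>w\<in>e j. of_bool (mate w \<in> displaced B))"
      if "j \<in> good" for j
      using sum_other[of j "\<lambda>w. of_bool (mate w \<in> hit B)"] that good_I
      by (auto simp: charge_def sum.distrib simp del: sum_of_bool_eq)
    then show ?thesis by (simp add: sum.distrib sum_distrib_left del: sum_of_bool_eq)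
  qed
  also have "\<dots> \<le> 2 * real (gain B) + real (gain B)"
    using sum_good_le[OF finite_hit, of B] sum_good_le[OF finite_displaced, of B] card_displaced[of B]
    by (simp add: card_hit del: sum_of_bool_eq)
  finally show ?thesis by simp
qed

end

subsection \<open>Random skipping and random arrival in the second phase\<close>

definition coins :: "nat \<Rightarrow> real \<Rightarrow> (nat \<Rightarrow> bool) pmf" where
  "coins n p = Pi_pmf {..<n} False (\<lambda>_. bernoulli_pmf p)"

lemma finite_coins [simp]: "finite (set_pmf (coins n p))"
  by (auto simp: coins_def set_Pi_pmf intro!: finite_PiE_dflt)

lemma integrable_coins [simp]: "integrable (measure_pmf (coins n p)) (f :: _ \<Rightarrow> real)"
  by (rule integrable_measure_pmf_finite) simp

text \<open>Coin \<open>j\<close> is independent of the other coins, and once it is overwritten the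
  integrand depends only on those.\<close>

lemma expectation_coins_toggle:
  fixes g :: "(nat \<Rightarrow> bool) \<Rightarrow> real"
  assumes "j < n" "0 \<le> p" "p \<le> 1"
  shows "measure_pmf.expectation (coins n p) (\<lambda>B. of_bool (B j) * g B) =
      p * measure_pmf.expectation (coins n p) (\<lambda>B. g (B(j := True)))" (is ?True)
    and "measure_pmf.expectation (coins n p) (\<lambda>B. of_bool (\<not> B j) * g B) =
      (1 - p) * measure_pmf.expectation (coins n p) (\<lambda>B. g (B(j := False)))" (is ?False)
proof -
  define Q where "Q = Pi_pmf ({..<n} - {j}) False (\<lambda>_. bernoulli_pmf p)"
  have finQ: "finite (set_pmf Q)"
    by (auto simp: Q_def set_Pi_pmf intro!: finite_PiE_dflt)
  have ins: "{..<n} = insert j ({..<n} - {j})" using assms by auto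
  have "coins n p = bernoulli_pmf p \<bind> (\<lambda>y. map_pmf (\<lambda>f. f(j := y)) Q)"
    unfolding coins_def Q_def
    by (subst ins, subst Pi_pmf_insert') (auto simp: map_pmf_def)
  then have *: "measure_pmf.expectation (coins n p) h =
      p * measure_pmf.expectation Q (\<lambda>f. h (f(j := True))) +
      (1 - p) * measure_pmf.expectation Q (\<lambda>f. h (f(j := False)))" for h :: "_ \<Rightarrow> real"
    using assms finQ by (simp only:, subst pmf_expectation_bind[of UNIV]) (auto simp: UNIV_bool)
  show ?True ?False
    by (simp_all add: * algebra_simps)
qed

context skipped_pairs
begin

text \<open>The gain bounds its own losses. Matched ends of \<open>j\<close> are seen when coin
  \<open>j\<close> is true, with probability \<open>p\<close>, and charges when it is false, with
  probability \<open>1 - p\<close>. Summed over good pairs, the charges cost at most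
  \<open>3 * p / (1 - p)\<close> times the expected gain, which is little for small
  \<open>p\<close>.\<close>

lemma expectation_gain_ge:
  assumes "I \<subseteq> {..<n}" "0 < p" "p < 1"
  shows "p * (2 * real (card good) - (\<Sum>j\<in>good. clash j)) \<le>
    (1 + 3 * p / (1 - p)) * measure_pmf.expectation (coins n p) (\<lambda>B. real (gain B))"
proof -
  let ?E = "measure_pmf.expectation (coins n p)"
  have lt: "j < n" if "j \<in> good" for j using that good_I assms by auto
  have p: "0 \<le> p" "p \<le> 1" using assms by auto
  define m where "m j B = real (card (e j \<inter> cov (blocked B) es))" for j B
  have "(\<Sum>j\<in>good. p * ?E (\<lambda>B. m j (B(j := True)))) = ?E (\<lambda>B. \<Sum>j\<in>good. of_bool (B j) * m j B)"
    using expectation_coins_toggle(1)[OF lt p] by simp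
  also have "\<dots> \<le> ?E (\<lambda>B. real (gain B))"
    using gain_ge by (intro integral_mono) (simp_all add: m_def)
  finally have 1: "(\<Sum>j\<in>good. p * ?E (\<lambda>B. m j (B(j := True)))) \<le> ?E (\<lambda>B. real (gain B))" .
  have "(1 - p) * (\<Sum>j\<in>good. ?E (\<lambda>B. charge (B(j := False)) j)) =
      ?E (\<lambda>B. \<Sum>j\<in>good. of_bool (\<not> B j) * charge B j)"
    using expectation_coins_toggle(2)[OF lt p] by (simp add: sum_distrib_left)
  also have "\<dots> \<le> ?E (\<lambda>B. 3 * real (gain B))"
    using sum_charge_le by (intro integral_mono) simp_all
  finally have "(1 - p) * (\<Sum>j\<in>good. ?E (\<lambda>B. charge (B(j := False)) j)) \<le> 3 * ?E (\<lambda>B. real (gain B))"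
    by simp
  then have 2: "(\<Sum>j\<in>good. ?E (\<lambda>B. charge (B(j := False)) j)) \<le> 3 * ?E (\<lambda>B. real (gain B)) / (1 - p)"
    using assms by (simp add: field_simps)
  have "2 \<le> ?E (\<lambda>B. m j (B(j := True))) + ?E (\<lambda>B. charge (B(j := False)) j) + clash j" if "j \<in> good" for j
  proof -
    have "2 = ?E (\<lambda>B. 2 :: real)" by simp
    also have "\<dots> \<le> ?E (\<lambda>B. m j (B(j := True)) + charge (B(j := False)) j + clash j)"
      using two_le_matched[OF that] unfolding m_def by (intro integral_mono) simp_all
    finally show ?thesis by simp
  qed
  then have "(\<Sum>j\<in>good. 2) \<le>
      (\<Sum>j\<in>good. ?E (\<lambda>B. m j (B(j := True))) + ?E (\<lambda>B. charge (B(j := False)) j) + clash j)"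
    by (intro sum_mono)
  then have "2 * real (card good) - (\<Sum>j\<in>good. clash j) \<le>
      (\<Sum>j\<in>good. ?E (\<lambda>B. m j (B(j := True)))) + 3 * ?E (\<lambda>B. real (gain B)) / (1 - p)"
    using 2 by (simp add: sum.distrib)
  then have "p * (2 * real (card good) - (\<Sum>j\<in>good. clash j)) \<le>
      p * ((\<Sum>j\<in>good. ?E (\<lambda>B. m j (B(j := True)))) + 3 * ?E (\<lambda>B. real (gain B)) / (1 - p))"
    using assms by (intro mult_left_mono) auto
  also have "\<dots> \<le> (1 + 3 * p / (1 - p)) * ?E (\<lambda>B. real (gain B))"
    using 1 by (simp add: algebra_simps sum_distrib_left)
  finally show ?thesis .
qed

end

section \<open>Which of three edges arrives first\<close>

lemma sum_permutations_transpose: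
  assumes "x \<in> A" "y \<in> A"
  shows "(\<Sum>xs\<in>permutations_of_set A. f (map (Transposition.transpose x y) xs)) = (\<Sum>xs\<in>permutations_of_set A. f xs)"
proof -
  have "map (Transposition.transpose x y) ` permutations_of_set A = permutations_of_set A"
    using assms by (intro permutations_of_set_image_permutes permutes_swap_id)
  moreover have "inj_on (map (Transposition.transpose x y)) (permutations_of_set A)"
    by (auto intro!: inj_onI dest!: injD[OF inj_mapI[OF inj_transpose]])
  ultimately show ?thesis
    by (metis (mono_tags, lifting) sum.reindex_cong)
qed

lemma first_of_Nil [simp]: "\<not> first_of x y z []"
  by (simp add: first_of_def)

lemma first_of_Cons [simp]:
  "first_of x y z (w # xs) \<longleftrightarrow> w = x \<or> w \<noteq> y \<and> w \<noteq> z \<and> first_of x y z xs"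
proof
  assume "first_of x y z (w # xs)"
  then obtain pre post where "w # xs = pre @ x # post" "y \<notin> set pre" "z \<notin> set pre"
    by (auto simp: first_of_def)
  then show "w = x \<or> w \<noteq> y \<and> w \<noteq> z \<and> first_of x y z xs"
    by (cases pre) (auto simp: first_of_def)
next
  assume "w = x \<or> w \<noteq> y \<and> w \<noteq> z \<and> first_of x y z xs"
  then show "first_of x y z (w # xs)"
  proof
    assume "w = x"
    then have "w # xs = [] @ x # xs" by simp
    then show ?thesis unfolding first_of_def by fastforce
  next
    assume *: "w \<noteq> y \<and> w \<noteq> z \<and> first_of x y z xs"
    then obtain pre post where "w # xs = (w # pre) @ x # post" "y \<notin> set pre" "z \<notin> set pre"
      by (auto simp: first_of_def)
    moreover from this * have "y \<notin> set (w # pre)" "z \<notin> set (w # pre)" by auto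
    ultimately show ?thesis unfolding first_of_def by blast
  qed
qed

lemma first_of_find: "first_of x y z xs \<Longrightarrow> find (\<lambda>w. w \<in> {x, y, z}) xs = Some x"
  by (induction xs) auto

lemma first_of_filter: "first_of x y z (filter Q xs) \<Longrightarrow> Q y \<Longrightarrow> Q z \<Longrightarrow> first_of x y z xs"
  by (induction xs) (auto split: if_splits)

text \<open>Transpositions show that each of the three elements comes first equally often, and these
  events exclude each other. \<open>x\<close> may lie outside \<open>A\<close> because the edge from
  one end of a pair to the partner of the other need not be in the graph.\<close>

lemma sum_first_of_le:
  assumes A: "finite A" "y \<in> A" "z \<in> A" and ne: "x \<noteq> y" "x \<noteq> z" "y \<noteq> z"
  shows "(\<Sum>xs\<in>permutations_of_set A. of_bool (first_of x y z xs) :: real) \<le> fact (card A) / 3"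
proof (cases "x \<in> A")
  case True
  let ?S = "{x, y, z}"
  define c where "c w = (\<Sum>xs\<in>permutations_of_set A. of_bool (find (\<lambda>v. v \<in> ?S) xs = Some w) :: real)" for w
  have eq: "c w = c x" if "w \<in> ?S" for w
  proof -
    have "find (\<lambda>v. v \<in> ?S) (map (Transposition.transpose x w) xs) = map_option (Transposition.transpose x w) (find (\<lambda>v. v \<in> ?S) xs)" for xs
      using that ne by (induction xs) (auto simp: Transposition.transpose_def)
    then have "(find (\<lambda>v. v \<in> ?S) (map (Transposition.transpose x w) xs) = Some w) \<longleftrightarrow> (find (\<lambda>v. v \<in> ?S) xs = Some x)" for xs
      by (cases "find (\<lambda>v. v \<in> ?S) xs") (auto simp: Transposition.transpose_def split: if_splits)
    then show ?thesis
      using sum_permutations_transpose[of x A w "\<lambda>xs. of_bool (find (\<lambda>v. v \<in> ?S) xs = Some w) :: real"]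
        True A that by (auto simp: c_def simp del: sum_of_bool_eq)
  qed
  have "3 * c x = c x + c y + c z" using eq[of y] eq[of z] by simp
  also have "\<dots> = (\<Sum>xs\<in>permutations_of_set A. of_bool (find (\<lambda>v. v \<in> ?S) xs = Some x) +
      of_bool (find (\<lambda>v. v \<in> ?S) xs = Some y) + of_bool (find (\<lambda>v. v \<in> ?S) xs = Some z))"
    by (simp add: c_def sum.distrib del: sum_of_bool_eq)
  also have "\<dots> \<le> (\<Sum>xs\<in>permutations_of_set A. 1)"
    using ne by (intro sum_mono) auto
  finally have "3 * c x \<le> fact (card A)" using A by simp
  moreover have "(\<Sum>xs\<in>permutations_of_set A. of_bool (first_of x y z xs) :: real) \<le> c x"
    unfolding c_def using first_of_find[of x y z] by (intro sum_mono) (auto simp: of_bool_def)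
  ultimately show ?thesis by simp
next
  case False
  then have "\<not> first_of x y z xs" if "xs \<in> permutations_of_set A" for xs
    using permutations_of_setD(1)[OF that] by (auto simp: first_of_def)
  then show ?thesis by simp
qed

text \<open>Of the edges joining \<open>other j w\<close> to \<open>mate w\<close>, \<open>w\<close> to \<open>mate w\<close> and \<open>other j w\<close> to
  \<open>mate (other j w)\<close>, each is the first to arrive with the same probability, so out of the two
  new edges of a pair the clashes cost at most \<open>2/3\<close> in expectation.\<close>

lemma sum_expectation_gain_ge:
  assumes sp: "\<And>xs. xs \<in> permutations_of_set A \<Longrightarrow> skipped_pairs I e W mate L (filter Q xs)"
    and A: "finite A" and I: "I \<subseteq> {..<n}" and p: "0 < p" "p < 1"
  shows "4 / 3 * p * real (card (skipped_pairs.good I e W)) * fact (card A) \<le>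
    (1 + 3 * p / (1 - p)) * (\<Sum>xs\<in>permutations_of_set A.
      measure_pmf.expectation (coins n p) (\<lambda>B. real (skipped_pairs.gain I e (filter Q xs) B)))"
proof -
  let ?P = "permutations_of_set A"
  let ?G = "skipped_pairs.good I e W"
  let ?o = "skipped_pairs.other e"
  let ?f = "\<lambda>j w. (first_of {?o j w, mate w} {w, mate w} {?o j w, mate (?o j w)})"
  \<comment> \<open>The notions \<open>good\<close> and \<open>other\<close> do not depend on the
    arrival order, so any single permutation serves to unfold them.\<close>
  obtain xs0 where xs0: "xs0 \<in> ?P" using A permutations_of_set_empty_iff by blast
  interpret s: skipped_pairs I e W mate L "filter Q xs0" by (rule sp[OF xs0])
  have mate: "{w, mate w} \<in> A \<and> Q {w, mate w}" if "w \<in> W" for w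
    using s.mate_es[OF that] permutations_of_setD(1)[OF xs0] by auto
  have "(\<Sum>xs\<in>?P. of_bool (?f j w (filter Q xs)) :: real) \<le> fact (card A) / 3" if "j \<in> ?G" "w \<in> e j" for j w
  proof -
    have jI: "j \<in> I" "e j \<subseteq> W" using that by (auto simp: s.good_def)
    note o = s.other[OF jI(1) that(2)]
    have W: "w \<in> W" "?o j w \<in> W" using o jI by auto
    have L: "W \<inter> e j \<subseteq> L" using jI by (auto simp: s.L_eq)
    have notL: "mate w \<notin> L" "mate (?o j w) \<notin> L" using W s.mate_L by auto
    have inL: "w \<in> L" "?o j w \<in> L" using L W o by auto
    have ne: "mate w \<noteq> mate (?o j w)" using W o(2) s.mate_inj by (metis inj_onD)
    have "(\<Sum>xs\<in>?P. of_bool (?f j w (filter Q xs)) :: real) \<le> (\<Sum>xs\<in>?P. of_bool (?f j w xs))"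
      using mate W by (intro sum_mono) (auto simp: of_bool_def dest: first_of_filter)
    also have "\<dots> \<le> fact (card A) / 3"
    proof (rule sum_first_of_le[OF A])
      show "{w, mate w} \<in> A" "{?o j w, mate (?o j w)} \<in> A" using mate W by auto
    qed (use ne o(2) notL inL in \<open>auto simp: doubleton_eq_iff\<close>)
    finally show ?thesis .
  qed
  then have "(\<Sum>j\<in>?G. \<Sum>w\<in>e j. \<Sum>xs\<in>?P. of_bool (?f j w (filter Q xs)) :: real) \<le>
      (\<Sum>j\<in>?G. \<Sum>w\<in>e j. fact (card A) / 3)"
    by (intro sum_mono)
  also have "\<dots> = (\<Sum>j\<in>?G. 2 * (fact (card A) / 3))"
    using s.card_pair s.good_I by (intro sum.cong) auto
  finally have "(\<Sum>j\<in>?G. \<Sum>w\<in>e j. \<Sum>xs\<in>?P. of_bool (?f j w (filter Q xs)) :: real) \<le>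
      real (card ?G) * (2 / 3 * fact (card A))" by simp
  also have "(\<Sum>j\<in>?G. \<Sum>w\<in>e j. \<Sum>xs\<in>?P. of_bool (?f j w (filter Q xs)) :: real) =
      (\<Sum>xs\<in>?P. \<Sum>j\<in>?G. \<Sum>w\<in>e j. of_bool (?f j w (filter Q xs)))"
    by (subst sum.swap[of _ "?P"]) (rule sum.swap)
  also have "\<dots> = (\<Sum>xs\<in>?P. \<Sum>j\<in>?G. skipped_pairs.clash e mate (filter Q xs) j)"
    using sp by (intro sum.cong refl) (simp add: skipped_pairs.clash_def[OF sp] del: sum_of_bool_eq)
  finally have clash: "(\<Sum>xs\<in>?P. \<Sum>j\<in>?G. skipped_pairs.clash e mate (filter Q xs) j) \<le>
      real (card ?G) * (2 / 3 * fact (card A))" .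
  have "4 / 3 * p * real (card ?G) * fact (card A) =
      p * (2 * real (card ?G) * fact (card A) - real (card ?G) * (2 / 3 * fact (card A)))"
    by (simp add: algebra_simps)
  also have "\<dots> \<le> p * (2 * real (card ?G) * fact (card A) -
      (\<Sum>xs\<in>?P. \<Sum>j\<in>?G. skipped_pairs.clash e mate (filter Q xs) j))"
    using clash p by (intro mult_left_mono diff_left_mono) auto
  also have "\<dots> = (\<Sum>xs\<in>?P. p * (2 * real (card ?G) - (\<Sum>j\<in>?G. skipped_pairs.clash e mate (filter Q xs) j)))"
    using A by (simp add: sum_subtractf sum_distrib_left[symmetric])
  also have "\<dots> \<le> (\<Sum>xs\<in>?P. (1 + 3 * p / (1 - p)) *
      measure_pmf.expectation (coins n p) (\<lambda>B. real (skipped_pairs.gain I e (filter Q xs) B)))"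
    by (intro sum_mono skipped_pairs.expectation_gain_ge[OF sp I p])
  finally show ?thesis by (simp add: sum_distrib_left)
qed

subsection \<open>Online algorithms with a random seed\<close>

type_synonym det_alg = "(nat set \<times> bool) list \<Rightarrow> nat set \<Rightarrow> bool"

fun det_run :: "det_alg \<Rightarrow> (nat set \<times> bool) list \<Rightarrow> nat set list \<Rightarrow> (nat set \<times> bool) list" where
  "det_run D hist [] = hist"
| "det_run D hist (e # es) = det_run D (hist @ [(e, D hist e \<and> feasible hist e)]) es"

definition consistent :: "det_alg \<Rightarrow> (nat set \<times> bool) list \<Rightarrow> bool" where
  "consistent D hist \<longleftrightarrow> (\<forall>i<length hist.
    snd (hist ! i) = (D (take i hist) (fst (hist ! i)) \<and> feasible (take i hist) (fst (hist ! i))))"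

lemma consistent_Nil [simp]: "consistent D []"
  by (simp add: consistent_def)

lemma consistent_snoc:
  "consistent D (hist @ [(e, b)]) \<longleftrightarrow> consistent D hist \<and> b = (D hist e \<and> feasible hist e)"
  by (auto simp: consistent_def less_Suc_eq nth_append)

text \<open>Randomising over deterministic algorithms once at the start is equivalent to deciding
  each edge by the posterior distribution of the seed given the history.\<close>

definition posterior_alg :: "(nat \<Rightarrow> 's pmf) \<Rightarrow> (nat \<Rightarrow> 's \<Rightarrow> det_alg) \<Rightarrow> online_alg" where
  "posterior_alg P D m hist e =
    map_pmf (\<lambda>s. D m s hist e) (cond_pmf (P m) {s. consistent (D m s) hist})"

lemma cond_cond_pmf:
  assumes "set_pmf p \<inter> (A \<inter> B) \<noteq> {}"
  shows "cond_pmf (cond_pmf p A) B = cond_pmf p (A \<inter> B)"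
proof (rule pmf_eqI)
  fix x
  have A: "set_pmf p \<inter> A \<noteq> {}" using assms by auto
  then have B: "set_pmf (cond_pmf p A) \<inter> B \<noteq> {}" using assms by (simp add: Int_assoc)
  have "measure (measure_pmf (cond_pmf p A)) B = measure (measure_pmf p) (A \<inter> B) / measure (measure_pmf p) A"

    using emeasure_measure_pmf_not_zero[OF A] by (simp add: cond_pmf.rep_eq[OF A])
  moreover have "measure (measure_pmf p) A \<noteq> 0" using A measure_measure_pmf_not_zero by metis
  ultimately show "pmf (cond_pmf (cond_pmf p A) B) x = pmf (cond_pmf p (A \<inter> B)) x"
    by (simp add: pmf_cond[OF A] pmf_cond[OF B] pmf_cond[OF assms])
qed

text \<open>Invariant: given the history, the seed has its posterior distribution \<open>q\<close>.
  Drawing a seed from \<open>q\<close>, deciding by it, and then redrawing among the seeds with the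
  same decision gives \<open>q\<close> again, so the stepwise draws amount to one seed drawn at the
  start.\<close>

lemma run_posterior_alg_aux:
  assumes "set_pmf (P m) \<inter> {s. consistent (D m s) hist} \<noteq> {}"
  shows "run (posterior_alg P D) m hist es =
    map_pmf (\<lambda>s. det_run (D m s) hist es) (cond_pmf (P m) {s. consistent (D m s) hist})"
  using assms
proof (induction es arbitrary: hist)
  case Nil
  then show ?case by (simp add: map_pmf_const)
next
  case (Cons e es)
  let ?A = "{s. consistent (D m s) hist}"
  define q where "q = cond_pmf (P m) ?A"
  define g where "g s = (D m s hist e \<and> feasible hist e)" for s
  define K where "K s = det_run (D m s) (hist @ [(e, g s)]) es" for s
  have setq: "set_pmf q = set_pmf (P m) \<inter> ?A" using Cons.prems by (simp add: q_def set_cond_pmf)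
  have snoc: "{s. consistent (D m s) (hist @ [(e, b)])} = ?A \<inter> {s. b = g s}" for b
    by (auto simp: consistent_snoc g_def)
  have IH: "run (posterior_alg P D) m (hist @ [(e, g s)]) es = map_pmf K (cond_pmf q {s'. g s = g s'})"
    if s: "s \<in> set_pmf q" for s
  proof -
    have ne: "set_pmf (P m) \<inter> (?A \<inter> {s'. g s = g s'}) \<noteq> {}" using s setq by auto
    have "run (posterior_alg P D) m (hist @ [(e, g s)]) es =
        map_pmf (\<lambda>s'. det_run (D m s') (hist @ [(e, g s)]) es) (cond_pmf (P m) (?A \<inter> {s'. g s = g s'}))"
      using Cons.IH[of "hist @ [(e, g s)]"] ne unfolding snoc by blast
    also have "\<dots> = map_pmf K (cond_pmf (P m) (?A \<inter> {s'. g s = g s'}))"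
      by (rule map_pmf_cong[OF refl]) (auto simp: set_cond_pmf[OF ne] K_def)
    finally show ?thesis unfolding q_def by (simp add: cond_cond_pmf[OF ne])
  qed
  have "run (posterior_alg P D) m hist (e # es) =
      q \<bind> (\<lambda>s. run (posterior_alg P D) m (hist @ [(e, g s)]) es)"
    by (simp add: posterior_alg_def q_def g_def bind_map_pmf)
  also have "\<dots> = q \<bind> (\<lambda>s. map_pmf K (cond_pmf q {s'. g s = g s'}))"
    by (intro bind_pmf_cong refl IH)
  also have "\<dots> = map_pmf K (q \<bind> (\<lambda>s. cond_pmf q {s'. g s = g s'}))"
    by (simp add: map_bind_pmf)
  also have "q \<bind> (\<lambda>s. cond_pmf q {s'. g s = g s'}) = q"
    by (rule bind_cond_pmf_cancel) (auto intro!: arg_cong[of _ _ "measure (measure_pmf q)"])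
  finally show ?case by (simp add: K_def q_def g_def)
qed

lemma run_posterior_alg:
  "run (posterior_alg P D) m [] es = map_pmf (\<lambda>s. det_run (D m s) [] es) (P m)"
proof -
  have "cond_pmf (P m) UNIV = P m"
    by (rule pmf_eqI) (simp add: pmf_cond set_pmf_not_empty)
  then show ?thesis using run_posterior_alg_aux[of P m D "[]" es] by (simp add: set_pmf_not_empty)
qed

lemma expected_posterior_alg:
  assumes "finite E" "finite (set_pmf (P (card E)))"
  shows "expected_alg (posterior_alg P D) E = (\<Sum>es\<in>permutations_of_set E.
    measure_pmf.expectation (P (card E)) (\<lambda>s. real (matching_size (det_run (D (card E) s) [] es))))
      / fact (card E)"
  unfolding expected_alg_def run_posterior_alg
  using assms by (subst pmf_expectation_bind_pmf_of_set) (auto simp: sum_distrib_left divide_inverse mult.commute)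

definition picked :: "(nat set \<times> bool) list \<Rightarrow> nat set" where
  "picked hist = \<Union>{e. (e, True) \<in> set hist}"

lemma feasible_iff: "feasible hist e \<longleftrightarrow> e \<inter> picked hist = {}"
  by (force simp: feasible_def picked_def)

lemma picked_snoc: "picked (hist @ [(e, b)]) = picked hist \<union> (if b then e else {})"
  by (auto simp: picked_def)

lemma matching_size_snoc: "matching_size (hist @ [(e, b)]) = matching_size hist + of_bool b"
  by (simp add: matching_size_def)

lemma det_run_append: "det_run D hist (xs @ ys) = det_run D (det_run D hist xs) ys"
  by (induction xs arbitrary: hist) auto

text \<open>When decisions depend on the edge alone, the feasibility test turns the run into greedy
  on the wanted edges. This covers both the second phase and plain greedy.\<close>

lemma matching_size_filter:
  assumes "\<And>xs e. D (hist @ xs) e = Q e"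
  shows "matching_size (det_run D hist es) = matching_size hist + length (greedy (picked hist) (filter Q es))"
  using assms
proof (induction es arbitrary: hist)
  case (Cons e es)
  have "D hist e = Q e" using Cons.prems[of "[]"] by simp
  moreover have "matching_size (det_run D (hist @ [x]) es) =
      matching_size (hist @ [x]) + length (greedy (picked (hist @ [x])) (filter Q es))" for x
    using Cons.prems[of "x # _"] by (intro Cons.IH) simp
  ultimately show ?case
    by (auto simp: feasible_iff picked_snoc matching_size_snoc)
qed simp

section \<open>The skipping algorithm\<close>

definition chosen :: "nat set list \<Rightarrow> nat \<Rightarrow> bool" where
  "chosen es j \<longleftrightarrow> es ! j \<inter> cov {} (take j es) = {}"

text \<open>Greedy is simulated on the arrivals themselves, skipped edges included, so its cover is
  independent of \<open>B\<close>. After time \<open>l\<close> the cover is frozen, and conflicts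
  among the wanted edges are refused by \<open>feasible\<close>.\<close>

definition skip_alg :: "nat \<Rightarrow> (nat \<Rightarrow> bool) \<Rightarrow> det_alg" where
  "skip_alg l B hist e =
    (if length hist < l then e \<inter> cov {} (map fst hist) = {} \<and> \<not> B (length hist)
     else card (e \<inter> cov {} (map fst (take l hist))) = 1)"

lemma chosen_append: "j < length xs \<Longrightarrow> chosen (xs @ ys) j = chosen xs j"
  by (simp add: chosen_def nth_append)

text \<open>Greedy is rewritten in terms of arrival positions because the coins are indexed by
  positions.\<close>

lemma cov_chosen: "cov {} es = \<Union>(nth es ` {j. j < length es \<and> chosen es j})"
proof (induction es rule: rev_induct)
  case (snoc e es)
  have "{j. j < length (es @ [e]) \<and> chosen (es @ [e]) j} =
      {j. j < length es \<and> chosen es j} \<union> (if e \<inter> cov {} es = {} then {length es} else {})"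
    by (auto simp: less_Suc_eq chosen_append) (auto simp: chosen_def)
  then show ?case by (auto simp: cov_append snoc nth_append split: if_splits)
qed simp

lemma length_greedy_chosen: "length (greedy {} es) = card {j. j < length es \<and> chosen es j}"
proof (induction es rule: rev_induct)
  case (snoc e es)
  have "{j. j < length (es @ [e]) \<and> chosen (es @ [e]) j} =
      {j. j < length es \<and> chosen es j} \<union> (if e \<inter> cov {} es = {} then {length es} else {})"
    by (auto simp: less_Suc_eq chosen_append) (auto simp: chosen_def)
  then show ?case using snoc by (auto simp: greedy_append)
qed simp

lemma chosen_disjoint:
  assumes "i < length es" "j < length es" "i \<noteq> j" "chosen es i" "chosen es j"
  shows "es ! i \<inter> es ! j = {}"
proof -
  have *: "es ! i \<inter> es ! j = {}" if "i < j" "j < length es" "chosen es i" "chosen es j" for i j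
  proof -
    have "es ! i = take j es ! i" "i < length (take j es)" "chosen (take j es) i"
      using that chosen_append[of i "take j es" "drop j es"] by auto
    then have "es ! i \<subseteq> cov {} (take j es)"
      unfolding cov_chosen by (intro UN_upper[of i, THEN subset_trans[rotated]]) auto
    then show ?thesis using that by (auto simp: chosen_def)
  qed
  show ?thesis using *[of i j] *[of j i] assms by (cases i j rule: linorder_cases) auto
qed

lemma det_run_skip_alg:
  assumes "length es \<le> l"
  shows "det_run (skip_alg l B) [] es = map (\<lambda>j. (es ! j, chosen es j \<and> \<not> B j)) [0..<length es]"
  using assms
proof (induction es rule: rev_induct)
  case (snoc e es)
  let ?h = "map (\<lambda>j. (es ! j, chosen es j \<and> \<not> B j)) [0..<length es]"
  have fst: "map fst ?h = es" by (simp add: comp_def map_nth)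
  \<comment> \<open>The matching lies inside the simulated cover, so feasibility never interferes in
    the first phase.\<close>
  have "picked ?h \<subseteq> cov {} es" by (auto simp: picked_def cov_chosen)
  then have feas: "((e \<inter> cov {} es = {} \<and> \<not> B (length es)) \<and> feasible ?h e) =
      (chosen (es @ [e]) (length es) \<and> \<not> B (length es))"
    by (auto simp: feasible_iff chosen_def)
  have IH: "det_run (skip_alg l B) [] es = ?h" using snoc by simp
  have "skip_alg l B ?h e = (e \<inter> cov {} es = {} \<and> \<not> B (length es))"
    using snoc.prems unfolding skip_alg_def fst by simp
  then have "det_run (skip_alg l B) [] (es @ [e]) = ?h @ [(e, chosen (es @ [e]) (length es) \<and> \<not> B (length es))]"
    unfolding det_run_append IH det_run.simps using feas by simp
  moreover have "?h = map (\<lambda>j. ((es @ [e]) ! j, chosen (es @ [e]) j \<and> \<not> B j)) [0..<length es]"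
    by (auto simp: nth_append chosen_append)
  ultimately show ?case by simp
qed simp

lemma matching_size_skip_alg:
  assumes "length xs = l"
  shows "matching_size (det_run (skip_alg l B) [] (xs @ ys)) =
    card {j. j < l \<and> chosen xs j \<and> \<not> B j} +
    length (greedy (\<Union>(nth xs ` {j. j < l \<and> chosen xs j \<and> \<not> B j}))
      (filter (\<lambda>e. card (e \<inter> cov {} xs) = 1) ys))"
proof -
  let ?h = "map (\<lambda>j. (xs ! j, chosen xs j \<and> \<not> B j)) [0..<l]"
  have "det_run (skip_alg l B) [] (xs @ ys) = det_run (skip_alg l B) ?h ys"
    using assms by (simp add: det_run_append det_run_skip_alg)
  moreover have "skip_alg l B (?h @ zs) e = (card (e \<inter> cov {} xs) = 1)" for zs e
    using assms map_nth[of xs] by (simp add: skip_alg_def comp_def)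
  moreover have "matching_size ?h = card {j. j < l \<and> chosen xs j \<and> \<not> B j}"
    by (simp add: matching_size_def filter_map comp_def length_filter_conv_card conj_commute)
      (rule arg_cong[of _ _ card], auto)
  moreover have "picked ?h = \<Union>(nth xs ` {j. j < l \<and> chosen xs j \<and> \<not> B j})"
  proof -
    have "{e. (e, True) \<in> set ?h} = nth xs ` {j. j < l \<and> chosen xs j \<and> \<not> B j}"
      by (auto simp: image_iff)
    then show ?thesis by (simp add: picked_def)
  qed
  ultimately show ?thesis
    using matching_size_filter[of "skip_alg l B" ?h "\<lambda>e. card (e \<inter> cov {} xs) = 1" ys] by simp
qed

subsection \<open>Uniform permutations and the maximum matching\<close>

text \<open>Conditioning on the first \<open>l\<close> arrivals: the remaining edges then come in
  uniformly random order.\<close>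

lemma sum_permutations_split:
  assumes "finite A" "l \<le> card A"
  shows "(\<Sum>xs\<in>permutations_of_set A. f xs) =
    (\<Sum>xs\<in>{xs. distinct xs \<and> set xs \<subseteq> A \<and> length xs = l}. \<Sum>ys\<in>permutations_of_set (A - set xs). f (xs @ ys))"
proof -
  let ?X = "{xs. distinct xs \<and> set xs \<subseteq> A \<and> length xs = l}"
  have fin: "finite ?X"
    by (rule finite_subset[OF _ finite_lists_length_eq[OF assms(1), of l]]) auto
  have "permutations_of_set A = (\<lambda>(xs, ys). xs @ ys) ` (SIGMA xs:?X. permutations_of_set (A - set xs))"
  proof (intro equalityI subsetI)
    fix zs assume zs: "zs \<in> permutations_of_set A"
    note z = permutations_of_setD[OF zs]
    have "length zs = card A" using z by (metis distinct_card)
    moreover have "set (drop l zs) = A - set (take l zs)"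
      using z by (metis append_take_drop_id distinct_append set_append Diff_cancel Un_Diff Un_empty_left
          Diff_triv inf_commute)
    ultimately have "(take l zs, drop l zs) \<in> (SIGMA xs:?X. permutations_of_set (A - set xs))"
      using z assms set_take_subset[of l zs] by (auto intro!: permutations_of_setI)
    then show "zs \<in> (\<lambda>(xs, ys). xs @ ys) ` (SIGMA xs:?X. permutations_of_set (A - set xs))"
      by (rule rev_image_eqI) simp
  next
    fix zs assume "zs \<in> (\<lambda>(xs, ys). xs @ ys) ` (SIGMA xs:?X. permutations_of_set (A - set xs))"
    then obtain xs ys where "zs = xs @ ys" "distinct xs" "set xs \<subseteq> A" "ys \<in> permutations_of_set (A - set xs)"
      by auto
    then show "zs \<in> permutations_of_set A"
      using permutations_of_setD[of ys "A - set xs"] by (intro permutations_of_setI) auto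
  qed
  moreover have "inj_on (\<lambda>(xs, ys). xs @ ys) (SIGMA xs:?X. permutations_of_set (A - set xs))"
  proof (rule inj_onI)
    fix p q assume "p \<in> (SIGMA xs:?X. permutations_of_set (A - set xs))" "q \<in> (SIGMA xs:?X. permutations_of_set (A - set xs))"
      and eq: "(\<lambda>(xs, ys). xs @ ys) p = (\<lambda>(xs, ys). xs @ ys) q"
    then have "length (fst p) = length (fst q)" by (elim SigmaE) simp
    then show "p = q" using eq by (simp add: split_beta prod_eq_iff)
  qed
  ultimately have "(\<Sum>xs\<in>permutations_of_set A. f xs) =
      (\<Sum>(xs, ys)\<in>(SIGMA xs:?X. permutations_of_set (A - set xs)). f (xs @ ys))"
    by (simp add: sum.reindex case_prod_beta' comp_def)
  then show ?thesis using fin by (simp add: sum.Sigma)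
qed

lemma sum_permutations_hd:
  fixes g :: "'a \<Rightarrow> real"
  assumes "finite A" "A \<noteq> {}"
  shows "(\<Sum>xs\<in>permutations_of_set A. g (hd xs)) = fact (card A - 1) * (\<Sum>x\<in>A. g x)"
proof -
  have "(\<Sum>xs\<in>permutations_of_set A. g (hd xs)) =
      (\<Sum>x\<in>A. \<Sum>xs\<in>(#) x ` permutations_of_set (A - {x}). g (hd xs))"
    unfolding permutations_of_set_nonempty[OF assms(2)]
    using assms(1) by (intro sum.UNION_disjoint) auto
  also have "\<dots> = (\<Sum>x\<in>A. fact (card A - 1) * g x)"
    using assms(1) by (intro sum.cong refl) (simp add: sum.reindex)
  finally show ?thesis by (simp add: sum_distrib_left)
qed

lemma sum_permutations_nth:
  assumes "finite A" "j < card A" "M \<subseteq> A"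
  shows "real (card A) * (\<Sum>xs\<in>permutations_of_set A. of_bool (xs ! j \<in> M)) = real (card M) * fact (card A)"
proof -
  let ?P = "permutations_of_set A"
  define c where "c x = (\<Sum>xs\<in>?P. of_bool (xs ! j = x) :: real)" for x
  have len: "length xs = card A" if "xs \<in> ?P" for xs
    using permutations_of_setD[OF that] by (metis distinct_card)
  have split: "(\<Sum>xs\<in>?P. of_bool (xs ! j \<in> B)) = (\<Sum>x\<in>B. c x)" if "B \<subseteq> A" for B
  proof -
    have "finite B" using finite_subset[OF that assms(1)] .
    then have "of_bool (xs ! j \<in> B) = (\<Sum>x\<in>B. of_bool (xs ! j = x) :: real)" for xs
      by (simp add: of_bool_def)
    then show ?thesis unfolding c_def by (simp add: sum.swap[of _ ?P] del: sum_of_bool_eq)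
  qed
  have eq: "c x = c y" if "x \<in> A" "y \<in> A" for x y
  proof -
    have "(map (Transposition.transpose x y) xs ! j = y) = (xs ! j = x)" if "xs \<in> ?P" for xs
      using len[OF that] assms(2) by (auto simp: Transposition.transpose_def)
    then have "c x = (\<Sum>xs\<in>?P. of_bool (map (Transposition.transpose x y) xs ! j = y))"
      unfolding c_def by (intro sum.cong) auto
    also have "\<dots> = c y" unfolding c_def by (rule sum_permutations_transpose[OF that])
    finally show ?thesis .
  qed
  have "xs ! j \<in> A" if "xs \<in> ?P" for xs
    using permutations_of_setD(1)[OF that] len[OF that] assms(2) by (metis nth_mem)
  then have "(\<Sum>x\<in>A. c x) = (\<Sum>xs\<in>?P. 1)"
    unfolding split[OF order_refl, symmetric] by (intro sum.cong) auto
  then have all: "(\<Sum>x\<in>A. c x) = fact (card A)" using assms(1) by simp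
  have "real (card A) * c x = fact (card A)" if "x \<in> A" for x
    using all eq[OF _ that] by (simp add: sum.cong[of A A c "\<lambda>_. c x"])
  then have "(\<Sum>x\<in>M. real (card A) * c x) = (\<Sum>x\<in>M. fact (card A))"
    using assms(3) by (intro sum.cong) auto
  then show ?thesis using split[OF assms(3)] by (simp add: sum_distrib_left)
qed

section \<open>An arbitrary matching against the cover of greedy\<close>

locale graph_matching =
  fixes E M :: "nat set set"
  assumes graph: "is_graph E" and matching: "is_matching E M"
begin

lemma finite_E: "finite E" and card_edge: "e \<in> E \<Longrightarrow> card e = 2"
  using graph by (auto simp: is_graph_def)

lemma finite_edge: "e \<in> E \<Longrightarrow> finite e"
  using card_edge by (metis card.infinite zero_neq_numeral)

lemma edge_nonempty: "e \<in> E \<Longrightarrow> e \<noteq> {}"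
  using card_edge by fastforce

lemma M_E: "M \<subseteq> E" and M_disj: "e \<in> M \<Longrightarrow> f \<in> M \<Longrightarrow> e \<noteq> f \<Longrightarrow> e \<inter> f = {}"
  using matching by (auto simp: is_matching_def)

lemma finite_M: "finite M" using finite_subset[OF M_E finite_E] .

definition free :: "nat set list \<Rightarrow> nat set set" where
  "free es = {g \<in> M. g \<inter> cov {} es = {}}"

text \<open>An edge that has already arrived is excluded, so that a crossing edge is sure to come in
  the second phase.\<close>

definition crossing :: "nat set list \<Rightarrow> nat set set" where
  "crossing es = {g \<in> M. card (g \<inter> cov {} es) = 1 \<and> g \<notin> set es}"

lemma card_cov:
  assumes "set es \<subseteq> E"
  shows "finite (cov {} es)" "card (cov {} es) = 2 * length (greedy {} es)"
proof -
  show "finite (cov {} es)" using assms finite_edge by (intro finite_cov) auto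
  show "card (cov {} es) = 2 * length (greedy {} es)"
    using card_cov_Int[of "{}" es UNIV 2] assms finite_edge card_edge by auto
qed

lemma sum_touched_le:
  assumes "set es \<subseteq> E"
  shows "(\<Sum>g\<in>M. card (g \<inter> cov {} es)) \<le> 2 * length (greedy {} es)"
proof -
  have "(\<Sum>g\<in>M. card (g \<inter> cov {} es)) = card (\<Union>g\<in>M. g \<inter> cov {} es)"
    using finite_M M_disj card_cov(1)[OF assms] by (intro card_UN_disjoint[symmetric]) auto
  also have "\<dots> \<le> card (cov {} es)" using card_cov(1)[OF assms] by (intro card_mono) auto
  finally show ?thesis using card_cov(2)[OF assms] by simp
qed

text \<open>Count the covered ends of \<open>M\<close>: maximality gives one per edge, and an edge
  picked by greedy has two. The picked edges are thus the surplus of greedy over one half.\<close>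

lemma two_greedy_ge:
  assumes "es \<in> permutations_of_set E"
  shows "card M + card (M \<inter> set (greedy {} es)) \<le> 2 * length (greedy {} es)"
proof -
  have es: "set es = E" using permutations_of_setD(1)[OF assms] .
  have "card M + card (M \<inter> set (greedy {} es)) = (\<Sum>g\<in>M. 1 + of_bool (g \<in> set (greedy {} es)))"
    using finite_M by (subst sum.distrib) simp
  also have "\<dots> \<le> (\<Sum>g\<in>M. card (g \<inter> cov {} es))"
  proof (rule sum_mono)
    fix g assume g: "g \<in> M"
    then have gE: "g \<in> E" using M_E by auto
    have "g \<inter> cov {} es \<noteq> {}" using cov_maximal[of g es] es gE edge_nonempty by auto
    then have "1 \<le> card (g \<inter> cov {} es)"
      using finite_edge[OF gE] by (metis One_nat_def Suc_leI card_gt_0_iff finite_Int)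
    moreover have "g \<inter> cov {} es = g" if "g \<in> set (greedy {} es)"
      using that by (auto simp: cov_def)
    ultimately show "1 + of_bool (g \<in> set (greedy {} es)) \<le> card (g \<inter> cov {} es)"
      using card_edge[OF gE] by auto
  qed
  also have "\<dots> \<le> 2 * length (greedy {} es)" using es by (intro sum_touched_le) auto
  finally show ?thesis .
qed

lemma card_M_le_free:
  assumes "set es \<subseteq> E"
  shows "card M \<le> 2 * length (greedy {} es) + card (free es)"
proof -
  have "card M = (\<Sum>g\<in>M. 1)" by simp
  also have "\<dots> \<le> (\<Sum>g\<in>M. card (g \<inter> cov {} es) + of_bool (g \<inter> cov {} es = {}))"
    using card_cov(1)[OF assms] by (intro sum_mono) (auto simp: Suc_le_eq card_gt_0_iff)
  also have "\<dots> = (\<Sum>g\<in>M. card (g \<inter> cov {} es)) + card (free es)"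
    using finite_M by (simp add: sum.distrib free_def Int_def)
  finally show ?thesis using sum_touched_le[OF assms] by linarith
qed

text \<open>Edge by edge: with two covered ends the bound is met, with one the edge is crossing or
  has arrived, with none it is free and counts twice.\<close>

lemma card_crossing_ge:
  assumes "set es \<subseteq> E"
  shows "2 * card M \<le> card (crossing es) + 2 * card (free es) + 2 * length (greedy {} es) + card (M \<inter> set es)"
proof -
  have "2 * card M = (\<Sum>g\<in>M. 2)" by simp
  also have "\<dots> \<le> (\<Sum>g\<in>M. of_bool (g \<in> crossing es) + 2 * of_bool (g \<inter> cov {} es = {})
      + card (g \<inter> cov {} es) + of_bool (g \<in> set es))"
  proof (rule sum_mono)
    fix g assume "g \<in> M"
    have "finite (g \<inter> cov {} es)" using card_cov(1)[OF assms] by simp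
    then have "g \<inter> cov {} es = {} \<longleftrightarrow> card (g \<inter> cov {} es) = 0" by simp
    then show "2 \<le> of_bool (g \<in> crossing es) + 2 * of_bool (g \<inter> cov {} es = {})
      + card (g \<inter> cov {} es) + of_bool (g \<in> set es)"
      using \<open>g \<in> M\<close> by (cases "card (g \<inter> cov {} es)" rule: nat.exhaust) (auto simp: crossing_def)
  qed
  also have "\<dots> = card (crossing es) + 2 * card (free es) + (\<Sum>g\<in>M. card (g \<inter> cov {} es)) + card (M \<inter> set es)"
    using finite_M by (simp add: sum.distrib sum_distrib_left[symmetric] free_def crossing_def Int_def conj_commute)
  finally show ?thesis using sum_touched_le[OF assms] by linarith
qed

definition touched :: "nat set list \<Rightarrow> nat set" where
  "touched es = (\<Union>g\<in>crossing es. g \<inter> cov {} es)"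

definition mate :: "nat \<Rightarrow> nat" where
  "mate w = (SOME v. v \<noteq> w \<and> {w, v} \<in> M)"

lemma card_touched:
  assumes "set es \<subseteq> E"
  shows "card (touched es) = card (crossing es)"
proof -
  have "card (touched es) = (\<Sum>g\<in>crossing es. card (g \<inter> cov {} es))"
    unfolding touched_def using finite_M M_disj card_cov(1)[OF assms]
    by (intro card_UN_disjoint) (auto simp: crossing_def)
  then show ?thesis by (simp add: crossing_def)
qed

lemma mate_crossing:
  assumes "w \<in> touched es"
  shows "{w, mate w} \<in> crossing es" "{w, mate w} \<inter> cov {} es = {w}" "mate w \<noteq> w"
proof -
  obtain g where g: "g \<in> crossing es" "w \<in> g" "w \<in> cov {} es" using assms by (auto simp: touched_def)
  then have gM: "g \<in> M" "card g = 2" "card (g \<inter> cov {} es) = 1"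
    using M_E card_edge by (auto simp: crossing_def)
  obtain x y where "g = {x, y}" "x \<noteq> y" using gM(2) by (auto simp: card_2_iff)
  then obtain v where v: "g = {w, v}" "v \<noteq> w" using g(2) by (cases "w = x") auto
  have "\<exists>v. v \<noteq> w \<and> {w, v} \<in> M" using v gM by auto
  then have m: "mate w \<noteq> w" "{w, mate w} \<in> M" unfolding mate_def by (metis (mono_tags, lifting) someI_ex)+
  then have gm: "{w, mate w} = g" using M_disj[OF m(2) gM(1)] g(2) by auto
  then show "{w, mate w} \<in> crossing es" "mate w \<noteq> w" using g m by auto
  obtain z where "g \<inter> cov {} es = {z}" using gM(3) by (rule card_1_singletonE)
  then have "g \<inter> cov {} es = {w}" using g by auto
  then show "{w, mate w} \<inter> cov {} es = {w}" using gm by simp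
qed

lemma mate_inj: "inj_on mate (touched es)"
proof (rule inj_onI)
  fix v w assume vw: "v \<in> touched es" "w \<in> touched es" "mate v = mate w"
  note m = mate_crossing[OF vw(1)] mate_crossing[OF vw(2)]
  have "{v, mate v} \<in> M" "{w, mate w} \<in> M" using m by (auto simp: crossing_def)
  then have "{v, mate v} = {w, mate w}" using M_disj vw(3) by fastforce
  then show "v = w" using m vw(3) by (auto simp: doubleton_eq_iff)
qed

definition chosen_set :: "nat set list \<Rightarrow> nat set" where
  "chosen_set es = {j. j < length es \<and> chosen es j}"

lemma skipped_pairs_prefix:
  assumes xs: "set xs \<subseteq> E" and ys: "ys \<in> permutations_of_set (E - set xs)"
  shows "skipped_pairs (chosen_set xs) (nth xs) (touched xs) mate (cov {} xs)
    (filter (\<lambda>f. card (f \<inter> cov {} xs) = 1) ys)"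
proof
  show "finite (chosen_set xs)" by (simp add: chosen_set_def)
  show "card (xs ! j) = 2" if "j \<in> chosen_set xs" for j
    using that card_edge[OF subsetD[OF xs nth_mem]] by (simp add: chosen_set_def)
  show "xs ! i \<inter> xs ! j = {}" if "i \<in> chosen_set xs" "j \<in> chosen_set xs" "i \<noteq> j" for i j
    using that by (intro chosen_disjoint) (auto simp: chosen_set_def)
  show "cov {} xs = \<Union> (nth xs ` chosen_set xs)" by (simp add: cov_chosen chosen_set_def)
  show "mate w \<notin> cov {} xs" if "w \<in> touched xs" for w using mate_crossing[OF that] by auto
  show "inj_on mate (touched xs)" by (rule mate_inj)
  have ys': "set ys = E - set xs" using permutations_of_setD(1)[OF ys] .
  show "card f = 2" "card (f \<inter> cov {} xs) = 1"
    if "f \<in> set (filter (\<lambda>f. card (f \<inter> cov {} xs) = 1) ys)" for f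
    using that ys' card_edge by auto
  show "{w, mate w} \<in> set (filter (\<lambda>f. card (f \<inter> cov {} xs) = 1) ys)" if "w \<in> touched xs" for w
    using mate_crossing(1)[OF that] ys' M_E by (auto simp: crossing_def)
qed

definition good_pairs :: "nat set list \<Rightarrow> nat set" where
  "good_pairs es = skipped_pairs.good (chosen_set es) (nth es) (touched es)"

text \<open>A greedy pair that is not good contains at most one touched vertex, so crossing edges
  number at most greedy edges plus good pairs. When greedy has about half of \<open>card M\<close>
  edges and few edges of \<open>M\<close> are free or have arrived, about half of
  \<open>card M\<close> pairs are good.\<close>

lemma card_good_pairs_ge:
  assumes "set xs \<subseteq> E"
  shows "2 * card M \<le> card (good_pairs xs) + 2 * card (free xs) + 3 * length (greedy {} xs) + card (M \<inter> set xs)"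
proof -
  obtain ys where ys: "ys \<in> permutations_of_set (E - set xs)"
    using finite_E permutations_of_set_empty_iff by blast
  interpret s: skipped_pairs "chosen_set xs" "nth xs" "touched xs" mate "cov {} xs"
    "filter (\<lambda>f. card (f \<inter> cov {} xs) = 1) ys"
    by (rule skipped_pairs_prefix[OF assms ys])
  have "touched xs \<subseteq> cov {} xs" by (auto simp: touched_def)
  then have "card (touched xs) = (\<Sum>j\<in>chosen_set xs. card (xs ! j \<inter> touched xs))" by (rule s.card_Int_L)
  also have "\<dots> \<le> (\<Sum>j\<in>chosen_set xs. 1 + of_bool (j \<in> s.good))"
  proof (rule sum_mono)
    fix j assume j: "j \<in> chosen_set xs"
    note c = s.card_pair[OF j] and f = s.finite_pair[OF j]
    show "card (xs ! j \<inter> touched xs) \<le> 1 + of_bool (j \<in> s.good)"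
    proof (cases "xs ! j \<subseteq> touched xs")
      case True
      then show ?thesis using j c card_mono[of "xs ! j" "xs ! j \<inter> touched xs"] f by (auto simp: s.good_def)
    next
      case False
      then have "card (xs ! j \<inter> touched xs) < card (xs ! j)" using f by (intro psubset_card_mono) auto
      then show ?thesis using c by simp
    qed
  qed
  also have "\<dots> = length (greedy {} xs) + card (good_pairs xs)"
    unfolding length_greedy_chosen good_pairs_def chosen_set_def[symmetric] sum.distrib
    using s.fin s.good_I by (simp add: Int_absorb1)
  finally show ?thesis using card_touched[OF assms] card_crossing_ge[OF assms] by linarith
qed

end

subsection \<open>Averages over the arrival order\<close>

context graph_matching
begin

lemma set_take_perm: "es \<in> permutations_of_set E \<Longrightarrow> set (take l es) \<subseteq> E"
  using set_take_subset[of l es] permutations_of_setD(1)[of es E] by simp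

lemma length_perm: "es \<in> permutations_of_set E \<Longrightarrow> length es = card E"
  using permutations_of_setD[of es E] by (metis distinct_card)

text \<open>Given the first \<open>t\<close> arrivals, the next one is uniform among at most
  \<open>card E\<close> remaining edges, and greedy picks it if it is a free edge of
  \<open>M\<close>.\<close>

lemma sum_free_le:
  assumes t: "t < card E"
  shows "(\<Sum>es\<in>permutations_of_set E. real (card (free (take t es)))) \<le>
    real (card E) * (\<Sum>es\<in>permutations_of_set E. of_bool (chosen es t \<and> es ! t \<in> M))"
proof -
  let ?X = "{xs. distinct xs \<and> set xs \<subseteq> E \<and> length xs = t}"
  have *: "(\<Sum>ys\<in>permutations_of_set (E - set xs). real (card (free (take t (xs @ ys))))) \<le>
      real (card E) * (\<Sum>ys\<in>permutations_of_set (E - set xs). of_bool (chosen (xs @ ys) t \<and> (xs @ ys) ! t \<in> M))"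
    if xs: "xs \<in> ?X" for xs
  proof -
    let ?A = "E - set xs"
    let ?n = "card ?A"
    have n: "?n = card E - t" using xs finite_E by (auto simp: card_Diff_subset distinct_card)
    have "?A \<noteq> {}"
    proof
      assume "?A = {}"
      then have "?n = 0" by (simp only: card.empty)
      then show False using n t by simp
    qed
    \<comment> \<open>By maximality an edge that has arrived meets the cover, so free edges are
      still to come.\<close>
    have "free xs \<subseteq> ?A"
      using M_E cov_maximal[of _ xs "{}"] edge_nonempty by (auto simp: free_def)
    then have free: "free xs = {g \<in> ?A. g \<in> M \<and> g \<inter> cov {} xs = {}}"
      by (auto simp: free_def)
    have "(\<Sum>ys\<in>permutations_of_set ?A. of_bool (chosen (xs @ ys) t \<and> (xs @ ys) ! t \<in> M)) =
        (\<Sum>ys\<in>permutations_of_set ?A. of_bool (hd ys \<in> M \<and> hd ys \<inter> cov {} xs = {}) :: real)"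
    proof (intro sum.cong refl)
      fix ys assume "ys \<in> permutations_of_set ?A"
      then have "set ys = ?A" by (rule permutations_of_setD)
      then have "ys \<noteq> []" using \<open>?A \<noteq> {}\<close> by (metis list.set(1))
      then show "of_bool (chosen (xs @ ys) t \<and> (xs @ ys) ! t \<in> M) =
          (of_bool (hd ys \<in> M \<and> hd ys \<inter> cov {} xs = {}) :: real)"
        using xs by (auto simp: chosen_def nth_append hd_conv_nth)
    qed
    also have "\<dots> = fact (?n - 1) * (\<Sum>g\<in>?A. of_bool (g \<in> M \<and> g \<inter> cov {} xs = {}))"
      using finite_E \<open>?A \<noteq> {}\<close>
      by (intro sum_permutations_hd[where g = "\<lambda>g. of_bool (g \<in> M \<and> g \<inter> cov {} xs = {})"]) auto
    also have "(\<Sum>g\<in>?A. of_bool (g \<in> M \<and> g \<inter> cov {} xs = {})) = real (card (free xs))"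
      unfolding free using finite_E by (simp add: Int_def)
    finally have sum: "(\<Sum>ys\<in>permutations_of_set ?A. of_bool (chosen (xs @ ys) t \<and> (xs @ ys) ! t \<in> M)) =
      fact (?n - 1) * real (card (free xs))" .
    have "fact ?n = real ?n * fact (?n - 1)" using n t by (intro fact_reduce) auto
    also have "\<dots> \<le> real (card E) * fact (?n - 1)" using n by (intro mult_right_mono) auto
    finally have "fact ?n * real (card (free xs)) \<le> real (card E) * fact (?n - 1) * real (card (free xs))"
      by (intro mult_right_mono) auto
    then show ?thesis
      unfolding sum using xs finite_E by (simp add: mult.assoc)
  qed
  show ?thesis
    unfolding sum_permutations_split[OF finite_E less_imp_le[OF t]]
    by (subst sum_distrib_left) (intro sum_mono *)
qed

lemma card_M_Int_greedy:
  assumes "es \<in> permutations_of_set E"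
  shows "real (card (M \<inter> set (greedy {} es))) = (\<Sum>t<card E. of_bool (chosen es t \<and> es ! t \<in> M))"
proof -
  have set_greedy: "set (greedy {} es) = nth es ` chosen_set es"
  proof -
    have "set (greedy {} es) = nth es ` {j. j < length es \<and> chosen es j}"
    proof (induction es rule: rev_induct)
      case (snoc e es)
      have "{j. j < length (es @ [e]) \<and> chosen (es @ [e]) j} =
          {j. j < length es \<and> chosen es j} \<union> (if e \<inter> cov {} es = {} then {length es} else {})"
        by (auto simp: less_Suc_eq chosen_append) (auto simp: chosen_def)
      then show ?case using snoc by (auto simp: greedy_append nth_append image_iff split: if_splits)
    qed simp
    then show ?thesis by (simp add: chosen_set_def)
  qed
  have "M \<inter> set (greedy {} es) = nth es ` {t. t < card E \<and> chosen es t \<and> es ! t \<in> M}"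
    using length_perm[OF assms] by (auto simp: set_greedy chosen_set_def)
  also have "card \<dots> = card {t. t < card E \<and> chosen es t \<and> es ! t \<in> M}"
    using length_perm[OF assms] permutations_of_setD(2)[OF assms]
    by (intro card_image inj_on_nth) auto
  finally show ?thesis by (simp add: Int_def lessThan_def)
qed

text \<open>The hastiness of greedy: free edges only become fewer, so each of the first
  \<open>l\<close> steps picks an edge of \<open>M\<close> with probability at least the final
  average number of free edges divided by \<open>card E\<close>.\<close>

lemma sum_free_greedy_le:
  assumes "l \<le> card E"
  shows "real l * (\<Sum>es\<in>permutations_of_set E. real (card (free (take l es)))) \<le>
    real (card E) * (\<Sum>es\<in>permutations_of_set E. real (card (M \<inter> set (greedy {} es))))"
proof -
  let ?P = "permutations_of_set E"
  have mono: "card (free (take l es)) \<le> card (free (take t es))" if "t < l" for t es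
  proof -
    have "take l es = take t es @ drop t (take l es)"
      using that by (metis append_take_drop_id min.absorb1 less_imp_le take_take)
    then have "cov {} (take t es) \<subseteq> cov {} (take l es)" using cov_append_superset by metis
    then show ?thesis using finite_M by (intro card_mono) (auto simp: free_def)
  qed
  have "real l * (\<Sum>es\<in>?P. real (card (free (take l es)))) = (\<Sum>t<l. \<Sum>es\<in>?P. real (card (free (take l es))))"
    by simp
  also have "\<dots> \<le> (\<Sum>t<l. \<Sum>es\<in>?P. real (card (free (take t es))))"
    using mono by (intro sum_mono) auto
  also have "\<dots> \<le> (\<Sum>t<l. real (card E) * (\<Sum>es\<in>?P. of_bool (chosen es t \<and> es ! t \<in> M)))"
    using assms by (intro sum_mono sum_free_le) auto
  also have "\<dots> \<le> (\<Sum>t<card E. real (card E) * (\<Sum>es\<in>?P. of_bool (chosen es t \<and> es ! t \<in> M)))"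
    using assms by (intro sum_mono2 mult_nonneg_nonneg sum_nonneg) auto
  also have "\<dots> = real (card E) * (\<Sum>es\<in>?P. \<Sum>t<card E. of_bool (chosen es t \<and> es ! t \<in> M))"
    by (simp only: sum.swap[of _ "{..<card E}"] sum_distrib_left)
  also have "\<dots> = real (card E) * (\<Sum>es\<in>?P. real (card (M \<inter> set (greedy {} es))))"
    by (intro arg_cong2[where f = "(*)"] sum.cong refl) (simp only: card_M_Int_greedy)
  finally show ?thesis .
qed

text \<open>The very first arrival is always picked and lies in \<open>M\<close> with probability
  \<open>card M / card E\<close>. This deals with graphs having too few edges for a first
  phase.\<close>

lemma card_M_le_greedy:
  assumes "0 < card E"
  shows "real (card M) * fact (card E) \<le>
    real (card E) * (\<Sum>es\<in>permutations_of_set E. real (card (M \<inter> set (greedy {} es))))"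
proof -
  have "real (card M) * fact (card E) = (\<Sum>es\<in>permutations_of_set E. real (card (free (take 0 es))))"
    using finite_E by (simp add: free_def)
  also have "\<dots> \<le> real (card E) * (\<Sum>es\<in>permutations_of_set E. of_bool (chosen es 0 \<and> es ! 0 \<in> M))"
    by (rule sum_free_le[OF assms])
  also have "\<dots> \<le> real (card E) * (\<Sum>es\<in>permutations_of_set E. real (card (M \<inter> set (greedy {} es))))"
  proof (intro mult_left_mono sum_mono)
    fix es assume "es \<in> permutations_of_set E"
    show "of_bool (chosen es 0 \<and> es ! 0 \<in> M) \<le> real (card (M \<inter> set (greedy {} es)))"
      unfolding card_M_Int_greedy[OF \<open>es \<in> _\<close>] using assms
      by (intro member_le_sum[of 0 "{..<card E}" "\<lambda>t. of_bool (chosen es t \<and> es ! t \<in> M)"]) auto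
  qed auto
  finally show ?thesis .
qed

lemma sum_prefix_M:
  assumes "l \<le> card E"
  shows "real (card E) * (\<Sum>es\<in>permutations_of_set E. real (card (M \<inter> set (take l es)))) \<le>
    real l * real (card M) * fact (card E)"
proof -
  let ?P = "permutations_of_set E"
  have "real (card (M \<inter> set (take l es))) \<le> (\<Sum>j<l. of_bool (es ! j \<in> M))" if "es \<in> ?P" for es
  proof -
    have "M \<inter> set (take l es) \<subseteq> nth es ` {j. j < l \<and> es ! j \<in> M}"
      using length_perm[OF that] assms by (auto simp: in_set_conv_nth)
    then have "card (M \<inter> set (take l es)) \<le> card {j. j < l \<and> es ! j \<in> M}"
      using surj_card_le[of "{j. j < l \<and> es ! j \<in> M}"] by simp
    then show ?thesis by (simp add: Int_def lessThan_def)
  qed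
  then have "(\<Sum>es\<in>?P. real (card (M \<inter> set (take l es)))) \<le> (\<Sum>es\<in>?P. \<Sum>j<l. of_bool (es ! j \<in> M))"
    by (intro sum_mono)
  then have "real (card E) * (\<Sum>es\<in>?P. real (card (M \<inter> set (take l es)))) \<le>
      real (card E) * (\<Sum>es\<in>?P. \<Sum>j<l. of_bool (es ! j \<in> M))"
    by (intro mult_left_mono) auto
  also have "\<dots> = (\<Sum>j<l. real (card E) * (\<Sum>es\<in>?P. of_bool (es ! j \<in> M)))"
    by (simp only: sum.swap[of _ "{..<l}"] sum_distrib_left)
  also have "\<dots> = (\<Sum>j<l. real (card M) * fact (card E))"
    using assms finite_E M_E by (intro sum.cong refl sum_permutations_nth) auto
  finally show ?thesis by simp
qed

section \<open>The average matching size of the skipping algorithm\<close>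

definition skip_gain :: "(nat \<Rightarrow> bool) \<Rightarrow> nat set list \<Rightarrow> nat set list \<Rightarrow> nat" where
  "skip_gain B xs ys = skipped_pairs.gain (chosen_set xs) (nth xs) (filter (\<lambda>f. card (f \<inter> cov {} xs) = 1) ys) B"

lemma matching_size_skip_alg_eq:
  assumes es: "es \<in> permutations_of_set E" and l: "l \<le> card E"
  shows "real (matching_size (det_run (skip_alg l B) [] es)) =
    (\<Sum>j\<in>chosen_set (take l es). of_bool (\<not> B j) * 1) + real (skip_gain B (take l es) (drop l es))"
proof -
  let ?xs = "take l es"
  have len: "length ?xs = l" using length_perm[OF es] l by simp
  have "set (drop l es) = E - set ?xs"
    using permutations_of_setD[OF es] by (metis append_take_drop_id distinct_append set_append Diff_cancel
        Un_Diff Un_empty_left Diff_triv inf_commute)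
  then have ys: "drop l es \<in> permutations_of_set (E - set ?xs)"
    using permutations_of_setD(2)[OF es] by (intro permutations_of_setI) auto
  interpret s: skipped_pairs "chosen_set ?xs" "nth ?xs" "touched ?xs" mate "cov {} ?xs"
    "filter (\<lambda>f. card (f \<inter> cov {} ?xs) = 1) (drop l es)"
    by (rule skipped_pairs_prefix[OF set_take_perm[OF es] ys])
  have set_eq: "{j. j < l \<and> chosen ?xs j \<and> \<not> B j} = {j \<in> chosen_set ?xs. \<not> B j}"
    using len by (auto simp: chosen_set_def)
  have "(\<Sum>j\<in>chosen_set ?xs. of_bool (\<not> B j) * 1) = real (card {j \<in> chosen_set ?xs. \<not> B j})"
    using s.fin by (simp add: Int_def)
  then show ?thesis
    using matching_size_skip_alg[OF len, of B "drop l es"]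
    unfolding set_eq skip_gain_def s.gain_def s.blocked_def by simp
qed

text \<open>Each greedy edge of the first phase is kept with probability \<open>1 - p\<close>; for
  every fixed prefix, averaging over the rest gains at least \<open>c\<close> per good pair.\<close>

lemma sum_skip_alg_ge:
  assumes l: "l \<le> card E" and p: "0 < p" "p < 1"
  defines "c \<equiv> 4 / 3 * p / (1 + 3 * p / (1 - p))"
  shows "(\<Sum>es\<in>permutations_of_set E. (1 - p) * real (length (greedy {} (take l es))) +
      c * real (card (good_pairs (take l es)))) \<le>
    (\<Sum>es\<in>permutations_of_set E. measure_pmf.expectation (coins (card E) p)
      (\<lambda>B. real (matching_size (det_run (skip_alg l B) [] es))))"
proof -
  let ?P = "permutations_of_set E"
  let ?E = "measure_pmf.expectation (coins (card E) p)"
  let ?X = "{xs. distinct xs \<and> set xs \<subseteq> E \<and> length xs = l}"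
  define d where "d = 1 + 3 * p / (1 - p)"
  have pos: "0 < d" unfolding d_def using p by (intro add_pos_nonneg) auto
  have c: "c = 4 / 3 * p / d" by (simp add: c_def d_def)
  have per_prefix: "(\<Sum>ys\<in>permutations_of_set (E - set xs). c * real (card (good_pairs xs))) \<le>
      (\<Sum>ys\<in>permutations_of_set (E - set xs). ?E (\<lambda>B. real (skip_gain B xs ys)))" if xs: "xs \<in> ?X" for xs
  proof -
    have "4 / 3 * p * real (card (good_pairs xs)) * fact (card (E - set xs)) \<le>
      d * (\<Sum>ys\<in>permutations_of_set (E - set xs). ?E (\<lambda>B. real (skip_gain B xs ys)))"
      unfolding d_def good_pairs_def skip_gain_def
    proof (rule sum_expectation_gain_ge[OF skipped_pairs_prefix _ _ p])
      show "set xs \<subseteq> E" "finite (E - set xs)" using xs finite_E by auto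
      show "chosen_set xs \<subseteq> {..<card E}" using xs l by (auto simp: chosen_set_def)
    qed
    then show ?thesis using pos finite_E by (simp add: c field_simps)
  qed
  have gain: "(\<Sum>es\<in>?P. c * real (card (good_pairs (take l es)))) \<le>
      (\<Sum>es\<in>?P. ?E (\<lambda>B. real (skip_gain B (take l es) (drop l es))))"
    unfolding sum_permutations_split[OF finite_E l]
  proof (rule sum_mono)
    fix xs assume xs: "xs \<in> ?X"
    then have "take l (xs @ ys) = xs" "drop l (xs @ ys) = ys" for ys by auto
    then show "(\<Sum>ys\<in>permutations_of_set (E - set xs). c * real (card (good_pairs (take l (xs @ ys))))) \<le>
      (\<Sum>ys\<in>permutations_of_set (E - set xs). ?E (\<lambda>B. real (skip_gain B (take l (xs @ ys)) (drop l (xs @ ys)))))"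
      using per_prefix[OF xs] by (simp only:)
  qed
  have "?E (\<lambda>B. real (matching_size (det_run (skip_alg l B) [] es))) =
      (1 - p) * real (length (greedy {} (take l es))) + ?E (\<lambda>B. real (skip_gain B (take l es) (drop l es)))"
    if es: "es \<in> ?P" for es
  proof -
    have "?E (\<lambda>B. of_bool (\<not> B j) * 1) = 1 - p" if "j \<in> chosen_set (take l es)" for j
    proof -
      have "j < card E" using that length_perm[OF es] by (simp add: chosen_set_def)
      then show ?thesis using expectation_coins_toggle(2)[of j "card E" p "\<lambda>_. 1"] p
        by (simp only: Bochner_Integration.lebesgue_integral_const measure_pmf.prob_space) simp
    qed
    then have "(\<Sum>j\<in>chosen_set (take l es). ?E (\<lambda>B. of_bool (\<not> B j) * 1)) =
        (1 - p) * real (length (greedy {} (take l es)))"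
      by (simp add: length_greedy_chosen chosen_set_def)
    then show ?thesis
      unfolding matching_size_skip_alg_eq[OF es l]
      by (simp only: Bochner_Integration.integral_add Bochner_Integration.integral_sum integrable_coins)
  qed
  then show ?thesis using gain by (simp add: sum.distrib)
qed

end

subsection \<open>The competitive ratio\<close>

text \<open>Averages: \<open>T\<close> and \<open>t\<close> are the greedy sizes at the end and
  after \<open>l\<close> arrivals, \<open>X\<close> the greedy edges in \<open>M\<close>,
  \<open>phi\<close> the free edges, \<open>r\<close> the arrived edges of \<open>M\<close>,
  \<open>G\<close> the good pairs, \<open>V\<close> the skipping algorithm. Either \<open>T\<close>
  alone suffices, or \<open>X\<close> and hence \<open>phi\<close> are small, which makes
  \<open>t\<close> about \<open>k / 2\<close> and \<open>V\<close> clearly larger than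
  \<open>k / 2\<close>.\<close>

lemma competitive_real_arith:
  fixes k T X t phi r G V l m :: real
  assumes "2 * T \<ge> k + X" "k \<le> 2 * t + phi" "2 * k \<le> G + 2 * phi + 3 * t + r" "t \<le> T"
    and "l * phi \<le> m * X" "k \<le> m * X" "m * r \<le> l * k"
    and "V \<ge> (99 / 100) * t + (4 / 3 * (1 / 100) / (1 + 3 * (1 / 100) / (1 - 1 / 100))) * G"
    and l: "l \<le> m / 20" "m \<ge> 20 \<Longrightarrow> m / 40 \<le> l" and nn: "k > 0" "m > 0" "X \<ge> 0" "phi \<ge> 0" "G \<ge> 0" "t \<ge> 0"
  shows "(1 / 1000000) * V + (1 - 1 / 1000000) * T \<ge> (1 / 2 + 1 / 10 ^ 11) * k"
proof -
  \<comment> \<open>\<open>11 / 850\<close> is the gain per good pair at \<open>p = 1 / 100\<close>.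
    With \<open>t\<close> near \<open>k / 2\<close> and \<open>G\<close> about
    \<open>9 / 20 * k\<close> or more, it outweighs the loss \<open>t / 100\<close> from
    skipping.\<close>
  have V: "V \<ge> (99 / 100) * t + (11 / 850) * G"
    using assms(8) by (simp add: field_simps)
  show ?thesis
  proof (cases "T \<ge> (1 / 2 + 1 / 100000) * k")
    case True
    have "V \<ge> 0" using V nn by linarith
    then show ?thesis using True nn by (simp add: algebra_simps)
  next
    case False
    then have X: "X \<le> 2 / 100000 * k" using assms(1) by (simp add: algebra_simps)
    have "k \<le> m * (2 / 100000 * k)" using assms(6) mult_left_mono[OF X, of m] nn by linarith
    \<comment> \<open>\<open>X\<close> is at least \<open>k / m\<close>, so a small \<open>X\<close>
      forces a large \<open>m\<close>, for which \<open>l\<close> is at least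
      \<open>m / 40\<close>.\<close>
    then have m: "m \<ge> 20" using nn by (simp add: field_simps)
    then have "m / 40 * phi \<le> l * phi" using l(2) nn by (intro mult_right_mono) auto
    then have "m * phi \<le> m * (40 * X)" using assms(5) by (simp add: field_simps)
    then have phi: "phi \<le> 40 * X" using nn by simp
    have "l * k \<le> m / 20 * k" using l nn by (intro mult_right_mono) auto
    then have "m * r \<le> m * (k / 20)" using assms(7) by simp
    then have r: "r \<le> k / 20" using nn by simp
    \<comment> \<open>\<open>V\<close> may lose about \<open>20 * X\<close> through
      \<open>phi\<close>, but with weight \<open>1 / 1000000\<close> this is paid for by the surplus
      \<open>X / 2\<close> of \<open>T\<close>.\<close>
    show ?thesis
      using V X phi r assms(1-4) nn False by (simp add: algebra_simps)
  qed
qed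

section \<open>Mixing the skipping algorithm with plain greedy\<close>

definition seeds :: "nat \<Rightarrow> (bool \<times> (nat \<Rightarrow> bool)) pmf" where
  "seeds m = pair_pmf (bernoulli_pmf (1 / 1000000)) (coins m (1 / 100))"

text \<open>Accepting everything is greedy, since infeasible acceptances are not carried
  out.\<close>

definition seeded_alg :: "nat \<Rightarrow> bool \<times> (nat \<Rightarrow> bool) \<Rightarrow> det_alg" where
  "seeded_alg m s = (if fst s then skip_alg (m div 20) (snd s) else (\<lambda>_ _. True))"

lemma finite_seeds: "finite (set_pmf (seeds m))"
  by (simp add: seeds_def)

lemma expectation_seeds:
  fixes h :: "_ \<Rightarrow> real"
  shows "measure_pmf.expectation (seeds m) h =
    1 / 1000000 * measure_pmf.expectation (coins m (1 / 100)) (\<lambda>B. h (True, B)) +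
    (1 - 1 / 1000000) * measure_pmf.expectation (coins m (1 / 100)) (\<lambda>B. h (False, B))"
proof -
  have "seeds m = bernoulli_pmf (1 / 1000000) \<bind> (\<lambda>b. map_pmf (Pair b) (coins m (1 / 100)))"
    by (simp add: seeds_def pair_pmf_def map_pmf_def)
  then show ?thesis
    by (simp only:, subst pmf_expectation_bind[of UNIV]) (auto simp: UNIV_bool)
qed

lemma matching_size_accept_all:
  "matching_size (det_run (\<lambda>_ _. True) [] es) = length (greedy {} es)"
  using matching_size_filter[of "\<lambda>_ _. True" "[]" "\<lambda>_. True" es]
  by (simp add: matching_size_def picked_def)

lemma (in graph_matching) expected_seeded_alg_ge:
  "(1 / 2 + 1 / 10 ^ 11) * real (card M) \<le> expected_alg (posterior_alg seeds seeded_alg) E"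
proof -
  let ?P = "permutations_of_set E"
  let ?m = "card E"
  let ?l = "?m div 20"
  let ?V = "\<Sum>es\<in>?P. measure_pmf.expectation (coins ?m (1 / 100))
      (\<lambda>B. real (matching_size (det_run (skip_alg ?l B) [] es)))"
  define avg where "avg f = (\<Sum>es\<in>?P. f es) / fact ?m" for f :: "nat set list \<Rightarrow> real"
  define c :: real where "c = 4 / 3 * (1 / 100) / (1 + 3 * (1 / 100) / (1 - 1 / 100))"
  have "expected_alg (posterior_alg seeds seeded_alg) E =
      (1 / 1000000 * ?V + (1 - 1 / 1000000) * (\<Sum>es\<in>?P. real (length (greedy {} es)))) / fact ?m"
    unfolding expected_posterior_alg[OF finite_E finite_seeds] expectation_seeds
    by (simp add: seeded_alg_def matching_size_accept_all sum.distrib sum_distrib_left)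
  then have alg: "expected_alg (posterior_alg seeds seeded_alg) E =
      1 / 1000000 * (?V / fact ?m) + (1 - 1 / 1000000) * avg (\<lambda>es. real (length (greedy {} es)))"
    by (simp add: avg_def add_divide_distrib)
  have l: "?l \<le> ?m" by simp
  have avg_const: "avg (\<lambda>_. x) = x" for x using finite_E by (simp add: avg_def)
  have avg_add: "avg (\<lambda>es. f es + g es) = avg f + avg g" for f g
    by (simp add: avg_def sum.distrib add_divide_distrib)
  have avg_mult: "avg (\<lambda>es. x * f es) = x * avg f" for x f
    by (simp add: avg_def sum_distrib_left)
  have avg_mono: "avg f \<le> avg g" if "\<And>es. es \<in> ?P \<Longrightarrow> f es \<le> g es" for f g
    unfolding avg_def using that by (intro divide_right_mono sum_mono) auto
  have avg_nonneg: "0 \<le> avg f" if "\<And>es. 0 \<le> f es" for f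
    using avg_mono[of "\<lambda>_. 0" f] that by (simp add: avg_const)
  let ?T = "avg (\<lambda>es. real (length (greedy {} es)))"
  let ?t = "avg (\<lambda>es. real (length (greedy {} (take ?l es))))"
  let ?X = "avg (\<lambda>es. real (card (M \<inter> set (greedy {} es))))"
  let ?phi = "avg (\<lambda>es. real (card (free (take ?l es))))"
  let ?r = "avg (\<lambda>es. real (card (M \<inter> set (take ?l es))))"
  let ?G = "avg (\<lambda>es. real (card (good_pairs (take ?l es))))"
  show ?thesis
  proof (cases "card M = 0")
    case True
    have "0 \<le> ?V / fact ?m" by (intro divide_nonneg_nonneg sum_nonneg integral_nonneg) auto
    moreover have "0 \<le> ?T" by (rule avg_nonneg) simp
    ultimately show ?thesis using True by (simp add: alg)
  next
    case False
    then have m: "0 < ?m" using card_mono[OF finite_E M_E] by simp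
    show ?thesis unfolding alg
    proof (rule competitive_real_arith[where X = ?X and t = ?t and phi = ?phi and r = ?r and G = ?G
          and l = "real ?l" and m = "real ?m"])
      have "avg (\<lambda>es. real (card M) + real (card (M \<inter> set (greedy {} es)))) \<le> avg (\<lambda>es. 2 * real (length (greedy {} es)))"
      proof (rule avg_mono)
        fix es assume "es \<in> ?P"
        from two_greedy_ge[OF this]
        show "real (card M) + real (card (M \<inter> set (greedy {} es))) \<le> 2 * real (length (greedy {} es))"
          by linarith
      qed
      then show "real (card M) + ?X \<le> 2 * ?T" unfolding avg_add avg_const avg_mult .
      have "avg (\<lambda>_. real (card M)) \<le> avg (\<lambda>es. 2 * real (length (greedy {} (take ?l es))) + real (card (free (take ?l es))))"
      proof (rule avg_mono)
        fix es assume "es \<in> ?P"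
        from card_M_le_free[OF set_take_perm[OF this, of ?l]]
        show "real (card M) \<le> 2 * real (length (greedy {} (take ?l es))) + real (card (free (take ?l es)))"
          by linarith
      qed
      then show "real (card M) \<le> 2 * ?t + ?phi" unfolding avg_add avg_const avg_mult .
      have "avg (\<lambda>_. 2 * real (card M)) \<le> avg (\<lambda>es. real (card (good_pairs (take ?l es))) + 2 * real (card (free (take ?l es)))
          + 3 * real (length (greedy {} (take ?l es))) + real (card (M \<inter> set (take ?l es))))"
      proof (rule avg_mono)
        fix es assume "es \<in> ?P"
        from card_good_pairs_ge[OF set_take_perm[OF this, of ?l]]
        show "2 * real (card M) \<le> real (card (good_pairs (take ?l es))) + 2 * real (card (free (take ?l es)))
          + 3 * real (length (greedy {} (take ?l es))) + real (card (M \<inter> set (take ?l es)))"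
          by linarith
      qed
      then show "2 * real (card M) \<le> ?G + 2 * ?phi + 3 * ?t + ?r" unfolding avg_add avg_const avg_mult .
      have "length (greedy {} (take ?l es)) \<le> length (greedy {} es)" for es :: "nat set list"
        using greedy_append[of "{}" "take ?l es" "drop ?l es"] by simp
      then show "?t \<le> ?T" by (intro avg_mono) simp
      show "real ?l * ?phi \<le> real ?m * ?X"
        using divide_right_mono[OF sum_free_greedy_le[OF l], of "fact ?m"] by (simp add: avg_def)
      show "real (card M) \<le> real ?m * ?X"
        using divide_right_mono[OF card_M_le_greedy[OF m], of "fact ?m"] by (simp add: avg_def)
      show "real ?m * ?r \<le> real ?l * real (card M)"
        using divide_right_mono[OF sum_prefix_M[OF l], of "fact ?m"] by (simp add: avg_def)
      have "avg (\<lambda>es. (1 - 1 / 100) * real (length (greedy {} (take ?l es))) + c * real (card (good_pairs (take ?l es))))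
          \<le> ?V / fact ?m"
        unfolding avg_def c_def using sum_skip_alg_ge[OF l, of "1 / 100"] by (intro divide_right_mono) simp_all
      then show "99 / 100 * ?t + (4 / 3 * (1 / 100) / (1 + 3 * (1 / 100) / (1 - 1 / 100))) * ?G \<le> ?V / fact ?m"
        unfolding avg_add avg_mult c_def by simp
      show "real ?l \<le> real ?m / 20"
      proof -
        have "20 * ?l \<le> ?m" by simp
        then have "real (20 * ?l) \<le> real ?m" by (rule of_nat_mono)
        then show ?thesis by simp
      qed
      show "real ?m / 40 \<le> real ?l" if "20 \<le> real ?m"
      proof -
        have "20 \<le> ?m" using that by simp
        \<comment> \<open>Rounding down at most halves a quotient that is at least 1.\<close>
        then have "?m \<le> 40 * ?l" by presburger
        then have "real ?m \<le> real (40 * ?l)" by (rule of_nat_mono)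
        then show ?thesis by simp
      qed
    qed (use False m avg_nonneg in auto)
  qed
qed

theorem theorem2:
  shows "\<exists>\<delta>::real. \<delta> > 0 \<and> (\<exists>A :: online_alg. competitive A (1/2 + \<delta>))"
proof (intro exI conjI)
  show "competitive (posterior_alg seeds seeded_alg) (1/2 + 1 / 10 ^ 11)"
    unfolding competitive_def
  proof (intro allI impI)
    fix E assume E: "is_graph E"
    then have "finite E" by (simp add: is_graph_def)
    moreover have "{M. is_matching E M} \<subseteq> Pow E" by (auto simp: is_matching_def)
    ultimately have "finite {M. is_matching E M}" by (simp add: finite_subset)
    moreover have "is_matching E {}" by (simp add: is_matching_def)
    ultimately have "opt_matching_size E \<in> card ` {M. is_matching E M}"
      unfolding opt_matching_size_def by (intro Max_in) auto
    then obtain M where M: "is_matching E M" "card M = opt_matching_size E" by auto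
    interpret graph_matching E M using E M by unfold_locales
    show "(1/2 + 1 / 10 ^ 11) * real (opt_matching_size E) \<le> expected_alg (posterior_alg seeds seeded_alg) E"
      using expected_seeded_alg_ge M by simp
  qed
qed simp

end
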